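(* There exists a direct limits preserving functor $\Phi\colon\mathcal{S}\to\mathcal{D}_2$ such that the composition $\Pi\circ\Phi$ is (naturally) equivalent to the identity functor on $\mathcal{S}$.
   Context: A $\langle\vee,0\rangle$-semilattice $S$ is distributive if for all $a,b,c\in S$ with $c\leq a\vee b$ there are $a'\leq a$ and $b'\leq b$ in $S$ such that $c=a'\vee b'$. Distances. Let $S$ be a $\langle\vee,0\rangle$-semilattice and $X$ a set. A map $\delta\colon X\times X\to S$ is an $S$-valued distance on $X$ if $\delta(x,x)=0$, $\delta(x,y)=\delta(y,x)$, and $\delta(x,z)\leq\delta(x,y)\vee\delta(y,z)$ for all $x,y,z\in X$. The kernel of $\delta$ is $\{\langle x,y\rangle\in X\times X\mid\delta(x,y)=0\}$. The distance $\delta$ is a V-distance of type $2$ if for all $x,y\in X$ and all $a,b\in S$ with $\delta(x,y)\leq a\vee b$, there are $z_1,z_2\in X$ such that $\delta(x,z_1)\leq a$, $\delta(z_1,z_2)\leq b$, and $\delta(z_2,y)\leq a$. A morphism from a distance $\lambda\colon X\times X\to A$ to a distance $\mu\colon Y\times Y\to B$ is a pair $\langle f,\boldsymbol{f}\rangle$, where $\boldsymbol{f}\colon A\to B$ is a $\langle\vee,0\rangle$-homomorphism and $f\colon X\to Y$ is a map such that $\boldsymbol{f}(\lambda(x,y))=\mu(f(x),f(y))$ for all $x,y\in X$. Categories. (1) $\mathcal{S}$ is the category of all distributive $\langle\vee,0\rangle$-semilattices with $\langle\vee,0\rangle$-embeddings. (2) $\mathcal{D}$ is the category of all surjective distances $\delta\colon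 X\times X\to S$ with kernel the identity (i.e., $\delta(x,y)=0$ implies $x=y$) and $S$ a distributive $\langle\vee,0\rangle$-semilattice, with morphisms $\langle f,\boldsymbol{f}\rangle$ such that both $f$ and $\boldsymbol{f}$ are one-to-one. (3) $\mathcal{D}_2$ is the full subcategory of $\mathcal{D}$ consisting of all V-distances of type $2$. $\Pi\colon\mathcal{D}\to\mathcal{S}$ is the forgetful functor, sending $\delta\colon X\times X\to S$ to $S$ and $\langle f,\boldsymbol{f}\rangle$ to $\boldsymbol{f}$. Direct limits are colimits indexed by directed posets. *)

theory Defs
  imports "HOL-Algebra.Complete_Lattice"
begin

section \<open>Categories, functors, natural isomorphisms, colimits\<close>

text \<open>
  Categories are presented by hom-sets. The same element of the arrow type may belong to several
  hom-sets, so composition and the action of a functor on arrows take the objects involved as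
  arguments: \<open>Comp C A B D g f\<close> is the composite of \<open>f : A \<rightarrow> B\<close> and \<open>g : B \<rightarrow> D\<close>.
\<close>

record ('o, 'm) cat =
  Ob :: "'o set"
  Hom :: "'o \<Rightarrow> 'o \<Rightarrow> 'm set"
  Id :: "'o \<Rightarrow> 'm"
  Comp :: "'o \<Rightarrow> 'o \<Rightarrow> 'o \<Rightarrow> 'm \<Rightarrow> 'm \<Rightarrow> 'm"

locale category =
  fixes C :: "('o, 'm) cat"
  assumes Id_in_Hom: "A \<in> Ob C \<Longrightarrow> Id C A \<in> Hom C A A"
    and Comp_in_Hom:
      "\<lbrakk>A \<in> Ob C; B \<in> Ob C; D \<in> Ob C; f \<in> Hom C A B; g \<in> Hom C B D\<rbrakk>
        \<Longrightarrow> Comp C A B D g f \<in> Hom C A D"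
    and Comp_Id_right:
      "\<lbrakk>A \<in> Ob C; B \<in> Ob C; f \<in> Hom C A B\<rbrakk> \<Longrightarrow> Comp C A A B f (Id C A) = f"
    and Comp_Id_left:
      "\<lbrakk>A \<in> Ob C; B \<in> Ob C; f \<in> Hom C A B\<rbrakk> \<Longrightarrow> Comp C A B B (Id C B) f = f"
    and Comp_assoc:
      "\<lbrakk>A \<in> Ob C; B \<in> Ob C; D \<in> Ob C; E \<in> Ob C;
        f \<in> Hom C A B; g \<in> Hom C B D; h \<in> Hom C D E\<rbrakk>
        \<Longrightarrow> Comp C A D E h (Comp C A B D g f) = Comp C A B E (Comp C B D E h g) f"

definition full_subcategory :: "('o, 'm) cat \<Rightarrow> ('o \<Rightarrow> bool) \<Rightarrow> ('o, 'm) cat" where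
  "full_subcategory C P = C\<lparr>Ob := {A \<in> Ob C. P A}\<rparr>"

record ('o, 'm, 'p, 'n) funct =
  FOb :: "'o \<Rightarrow> 'p"
  FAr :: "'o \<Rightarrow> 'o \<Rightarrow> 'm \<Rightarrow> 'n"

locale is_funct = C: category C + D: category D
  for C :: "('o, 'm) cat" and D :: "('p, 'n) cat" +
  fixes F :: "('o, 'm, 'p, 'n) funct"
  assumes FOb_in_Ob: "A \<in> Ob C \<Longrightarrow> FOb F A \<in> Ob D"
    and FAr_in_Hom:
      "\<lbrakk>A \<in> Ob C; B \<in> Ob C; f \<in> Hom C A B\<rbrakk> \<Longrightarrow> FAr F A B f \<in> Hom D (FOb F A) (FOb F B)"
    and FAr_Id: "A \<in> Ob C \<Longrightarrow> FAr F A A (Id C A) = Id D (FOb F A)"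
    and FAr_Comp:
      "\<lbrakk>A \<in> Ob C; B \<in> Ob C; E \<in> Ob C; f \<in> Hom C A B; g \<in> Hom C B E\<rbrakk>
        \<Longrightarrow> FAr F A E (Comp C A B E g f) =
            Comp D (FOb F A) (FOb F B) (FOb F E) (FAr F B E g) (FAr F A B f)"

definition id_funct :: "('o, 'm, 'o, 'm) funct" where
  "id_funct = \<lparr>FOb = (\<lambda>A. A), FAr = (\<lambda>A B f. f)\<rparr>"

definition comp_funct ::
  "('p, 'n, 'q, 'k) funct \<Rightarrow> ('o, 'm, 'p, 'n) funct \<Rightarrow> ('o, 'm, 'q, 'k) funct" where
  "comp_funct G F =
    \<lparr>FOb = (\<lambda>A. FOb G (FOb F A)),
     FAr = (\<lambda>A B f. FAr G (FOb F A) (FOb F B) (FAr F A B f))\<rparr>"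

definition is_iso :: "('o, 'm) cat \<Rightarrow> 'o \<Rightarrow> 'o \<Rightarrow> 'm \<Rightarrow> bool" where
  "is_iso C A B f \<longleftrightarrow> f \<in> Hom C A B \<and>
    (\<exists>g \<in> Hom C B A. Comp C A B A g f = Id C A \<and> Comp C B A B f g = Id C B)"

definition naturally_isomorphic ::
  "('o, 'm) cat \<Rightarrow> ('p, 'n) cat \<Rightarrow> ('o, 'm, 'p, 'n) funct \<Rightarrow> ('o, 'm, 'p, 'n) funct \<Rightarrow> bool"
where
  "naturally_isomorphic C D F G \<longleftrightarrow>
    is_funct C D F \<and> is_funct C D G \<and>
    (\<exists>\<eta>. (\<forall>A \<in> Ob C. is_iso D (FOb F A) (FOb G A) (\<eta> A)) \<and>
         (\<forall>A \<in> Ob C. \<forall>B \<in> Ob C. \<forall>f \<in> Hom C A B.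
            Comp D (FOb F A) (FOb F B) (FOb G B) (\<eta> B) (FAr F A B f) =
            Comp D (FOb F A) (FOb G A) (FOb G B) (FAr G A B f) (\<eta> A)))"

definition is_cocone ::
  "('j, 'k) cat \<Rightarrow> ('o, 'm) cat \<Rightarrow> ('j, 'k, 'o, 'm) funct \<Rightarrow> 'o \<Rightarrow> ('j \<Rightarrow> 'm) \<Rightarrow> bool"
where
  "is_cocone J C G L \<iota> \<longleftrightarrow>
    L \<in> Ob C \<and> (\<forall>i \<in> Ob J. \<iota> i \<in> Hom C (FOb G i) L) \<and>
    (\<forall>i \<in> Ob J. \<forall>j \<in> Ob J. \<forall>u \<in> Hom J i j.
       Comp C (FOb G i) (FOb G j) L (\<iota> j) (FAr G i j u) = \<iota> i)"

definition is_colimit ::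
  "('j, 'k) cat \<Rightarrow> ('o, 'm) cat \<Rightarrow> ('j, 'k, 'o, 'm) funct \<Rightarrow> 'o \<Rightarrow> ('j \<Rightarrow> 'm) \<Rightarrow> bool"
where
  "is_colimit J C G L \<iota> \<longleftrightarrow>
    is_cocone J C G L \<iota> \<and>
    (\<forall>M \<kappa>. is_cocone J C G M \<kappa> \<longrightarrow>
      (\<exists>!h. h \<in> Hom C L M \<and> (\<forall>i \<in> Ob J. Comp C (FOb G i) L M h (\<iota> i) = \<kappa> i)))"

definition preserves_colimits_over ::
  "('j, 'k) cat \<Rightarrow> ('o, 'm) cat \<Rightarrow> ('p, 'n) cat \<Rightarrow> ('o, 'm, 'p, 'n) funct \<Rightarrow> bool"
where
  "preserves_colimits_over J C D F \<longleftrightarrow>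
    (\<forall>G L \<iota>. is_funct J C G \<and> is_colimit J C G L \<iota> \<longrightarrow>
      is_colimit J D (comp_funct F G) (FOb F L) (\<lambda>i. FAr F (FOb G i) L (\<iota> i)))"

text \<open>Directed posets are nonempty: an initial object is not a direct limit.\<close>

definition directed_poset :: "'i gorder \<Rightarrow> bool" where
  "directed_poset P \<longleftrightarrow>
    partial_order P \<and> carrier P \<noteq> {} \<and>
    (\<forall>i \<in> carrier P. \<forall>j \<in> carrier P. \<exists>k \<in> carrier P. i \<sqsubseteq>\<^bsub>P\<^esub> k \<and> j \<sqsubseteq>\<^bsub>P\<^esub> k)"

definition poset_cat :: "'i gorder \<Rightarrow> ('i, unit) cat" where
  "poset_cat P =
    \<lparr>Ob = carrier P, Hom = (\<lambda>i j. {u. i \<sqsubseteq>\<^bsub>P\<^esub> j}), Id = (\<lambda>i. ()), Comp = (\<lambda>i j k v u. ())\<rparr>"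


section \<open>Distributive semilattices and distances\<close>

text \<open>A \<open>\<langle>\<or>,0\<rangle>\<close>-semilattice is a poset with binary joins and a least element
  (\<open>\<squnion>\<close> and \<open>\<bottom>\<close> of the library).\<close>

locale join_semilattice_zero = upper_semilattice L + weak_partial_order_bottom L
  for L :: "'s gorder" (structure)

locale distributive_semilattice = join_semilattice_zero +
  assumes distributive:
    "\<lbrakk>a \<in> carrier L; b \<in> carrier L; c \<in> carrier L; c \<sqsubseteq> a \<squnion> b\<rbrakk>
      \<Longrightarrow> \<exists>a' \<in> carrier L. \<exists>b' \<in> carrier L. a' \<sqsubseteq> a \<and> b' \<sqsubseteq> b \<and> c = a' \<squnion> b'"

text \<open>Maps between carriers are extensional, so that equality of arrows is equality of
  maps on the carrier.\<close>

definition semilattice_homs :: "'s gorder \<Rightarrow> 't gorder \<Rightarrow> ('s \<Rightarrow> 't) set" where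
  "semilattice_homs A B =
    {f \<in> carrier A \<rightarrow>\<^sub>E carrier B.
      f \<bottom>\<^bsub>A\<^esub> = \<bottom>\<^bsub>B\<^esub> \<and> (\<forall>x \<in> carrier A. \<forall>y \<in> carrier A. f (x \<squnion>\<^bsub>A\<^esub> y) = f x \<squnion>\<^bsub>B\<^esub> f y)}"

record ('x, 's) distance_space =
  points :: "'x set"
  vals :: "'s gorder"
  dst :: "'x \<Rightarrow> 'x \<Rightarrow> 's"

locale distance =
  fixes \<delta> :: "('x, 's) distance_space"
  assumes vals_semilattice: "join_semilattice_zero (vals \<delta>)"
    and dst_in_vals: "\<lbrakk>x \<in> points \<delta>; y \<in> points \<delta>\<rbrakk> \<Longrightarrow> dst \<delta> x y \<in> carrier (vals \<delta>)"
    and dst_self: "x \<in> points \<delta> \<Longrightarrow> dst \<delta> x x = \<bottom>\<^bsub>vals \<delta>\<^esub>"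
    and dst_sym: "\<lbrakk>x \<in> points \<delta>; y \<in> points \<delta>\<rbrakk> \<Longrightarrow> dst \<delta> x y = dst \<delta> y x"
    and dst_triangle:
      "\<lbrakk>x \<in> points \<delta>; y \<in> points \<delta>; z \<in> points \<delta>\<rbrakk>
        \<Longrightarrow> dst \<delta> x z \<sqsubseteq>\<^bsub>vals \<delta>\<^esub> dst \<delta> x y \<squnion>\<^bsub>vals \<delta>\<^esub> dst \<delta> y z"

definition distance_kernel :: "('x, 's) distance_space \<Rightarrow> ('x \<times> 'x) set" where
  "distance_kernel \<delta> = {(x, y) \<in> points \<delta> \<times> points \<delta>. dst \<delta> x y = \<bottom>\<^bsub>vals \<delta>\<^esub>}"

definition surjective_distance :: "('x, 's) distance_space \<Rightarrow> bool" where
  "surjective_distance \<delta> \<longleftrightarrow>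
    (\<lambda>(x, y). dst \<delta> x y) ` (points \<delta> \<times> points \<delta>) = carrier (vals \<delta>)"

definition V_distance_type2 :: "('x, 's) distance_space \<Rightarrow> bool" where
  "V_distance_type2 \<delta> \<longleftrightarrow>
    distance \<delta> \<and>
    (\<forall>x \<in> points \<delta>. \<forall>y \<in> points \<delta>. \<forall>a \<in> carrier (vals \<delta>). \<forall>b \<in> carrier (vals \<delta>).
      dst \<delta> x y \<sqsubseteq>\<^bsub>vals \<delta>\<^esub> a \<squnion>\<^bsub>vals \<delta>\<^esub> b \<longrightarrow>
      (\<exists>z1 \<in> points \<delta>. \<exists>z2 \<in> points \<delta>.
        dst \<delta> x z1 \<sqsubseteq>\<^bsub>vals \<delta>\<^esub> a \<and> dst \<delta> z1 z2 \<sqsubseteq>\<^bsub>vals \<delta>\<^esub> b \<and> dst \<delta> z2 y \<sqsubseteq>\<^bsub>vals \<delta>\<^esub> a))"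

definition distance_morphisms ::
  "('x, 's) distance_space \<Rightarrow> ('y, 't) distance_space \<Rightarrow> (('x \<Rightarrow> 'y) \<times> ('s \<Rightarrow> 't)) set"
where
  "distance_morphisms \<delta> \<epsilon> =
    {(f, h). f \<in> points \<delta> \<rightarrow>\<^sub>E points \<epsilon> \<and> h \<in> semilattice_homs (vals \<delta>) (vals \<epsilon>) \<and>
      (\<forall>x \<in> points \<delta>. \<forall>y \<in> points \<delta>. h (dst \<delta> x y) = dst \<epsilon> (f x) (f y))}"


section \<open>The categories \<open>\<S>\<close>, \<open>\<D>\<close>, \<open>\<D>\<^sub>2\<close> and the forgetful functor\<close>

text \<open>The type variables play the role of the universe: the objects are the structures whose
  underlying sets are subsets of the given types. Identifying both type variables with one arbitrary
  infinite type gives the categories relative to that universe.\<close>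

definition S_cat :: "('s gorder, 's \<Rightarrow> 's) cat" where
  "S_cat =
    \<lparr>Ob = {A. distributive_semilattice A},
     Hom = (\<lambda>A B. {f \<in> semilattice_homs A B. inj_on f (carrier A)}),
     Id = (\<lambda>A. restrict (\<lambda>x. x) (carrier A)),
     Comp = (\<lambda>A B C g f. compose (carrier A) g f)\<rparr>"

definition D_cat :: "(('x, 's) distance_space, ('x \<Rightarrow> 'x) \<times> ('s \<Rightarrow> 's)) cat" where
  "D_cat =
    \<lparr>Ob = {\<delta>. distance \<delta> \<and> surjective_distance \<delta> \<and> distance_kernel \<delta> = Id_on (points \<delta>) \<and>
              distributive_semilattice (vals \<delta>)},
     Hom = (\<lambda>\<delta> \<epsilon>. {(f, h) \<in> distance_morphisms \<delta> \<epsilon>.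
              inj_on f (points \<delta>) \<and> inj_on h (carrier (vals \<delta>))}),
     Id = (\<lambda>\<delta>. (restrict (\<lambda>x. x) (points \<delta>), restrict (\<lambda>x. x) (carrier (vals \<delta>)))),
     Comp = (\<lambda>\<delta> \<epsilon> \<zeta> g f. (compose (points \<delta>) (fst g) (fst f),
                          compose (carrier (vals \<delta>)) (snd g) (snd f)))\<rparr>"

definition D2_cat :: "(('x, 's) distance_space, ('x \<Rightarrow> 'x) \<times> ('s \<Rightarrow> 's)) cat" where
  "D2_cat = full_subcategory D_cat V_distance_type2"

definition forget ::
  "(('x, 's) distance_space, ('x \<Rightarrow> 'x) \<times> ('s \<Rightarrow> 's), 's gorder, 's \<Rightarrow> 's) funct" where
  "forget = \<lparr>FOb = vals, FAr = (\<lambda>\<delta> \<epsilon> f. snd f)\<rparr>"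


subsection \<open>Well-definedness\<close>

lemma category_full_subcategory: "category C \<Longrightarrow> category (full_subcategory C P)"
  unfolding category_def full_subcategory_def by simp

lemma category_poset_cat:
  assumes "partial_order P"
  shows "category (poset_cat P)"
proof -
  interpret partial_order P by fact
  show ?thesis
    by unfold_locales (auto simp: poset_cat_def split: if_splits intro: le_trans)
qed

lemma compose_semilattice_homs:
  assumes "f \<in> semilattice_homs A B" "g \<in> semilattice_homs B C"
    and "join_semilattice_zero A"
  shows "compose (carrier A) g f \<in> semilattice_homs A C"
proof -
  interpret A: join_semilattice_zero A by fact
  show ?thesis
    using assms(1,2) A.bottom_closed A.join_closed
    unfolding semilattice_homs_def
    by (auto simp: compose_def PiE_iff extensional_def)
qed

lemma restrict_id_semilattice_homs:
  assumes "join_semilattice_zero A"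
  shows "restrict (\<lambda>x. x) (carrier A) \<in> semilattice_homs A A"
proof -
  interpret A: join_semilattice_zero A by fact
  show ?thesis
    unfolding semilattice_homs_def by auto
qed

lemma semilattice_homs_PiE: "f \<in> semilattice_homs A B \<Longrightarrow> f \<in> carrier A \<rightarrow>\<^sub>E carrier B"
  by (simp add: semilattice_homs_def)

lemma inj_on_compose_PiE:
  "\<lbrakk>f \<in> A \<rightarrow>\<^sub>E B; inj_on f A; inj_on g B\<rbrakk> \<Longrightarrow> inj_on (compose A g f) A"
  by (auto simp: inj_on_def compose_def PiE_iff)

lemma compose_restrict_right: "f \<in> A \<rightarrow>\<^sub>E B \<Longrightarrow> compose A f (restrict (\<lambda>x. x) A) = f"
  by (auto simp: compose_def fun_eq_iff PiE_iff extensional_def)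

lemma compose_restrict_left: "f \<in> A \<rightarrow>\<^sub>E B \<Longrightarrow> compose A (restrict (\<lambda>x. x) B) f = f"
  by (auto simp: compose_def fun_eq_iff PiE_iff extensional_def)

lemma compose_assoc_PiE:
  "f \<in> A \<rightarrow>\<^sub>E B \<Longrightarrow> compose A h (compose A g f) = compose A (compose B h g) f"
  by (auto simp: compose_def fun_eq_iff PiE_iff)

lemma distributive_semilattice_join_semilattice_zero:
  "distributive_semilattice A \<Longrightarrow> join_semilattice_zero A"
  by (simp add: distributive_semilattice_def)

lemma category_S_cat: "category S_cat"
proof (unfold_locales, goal_cases)
  case (1 A)
  then show ?case
    by (auto simp: S_cat_def inj_on_def
        intro: restrict_id_semilattice_homs distributive_semilattice_join_semilattice_zero)
next
  case (2 A B D f g)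
  then show ?case
    by (auto simp: S_cat_def intro: compose_semilattice_homs
        inj_on_compose_PiE[OF semilattice_homs_PiE]
        distributive_semilattice_join_semilattice_zero)
next
  case (3 A B f)
  then show ?case
    by (auto simp: S_cat_def intro: compose_restrict_right[OF semilattice_homs_PiE])
next
  case (4 A B f)
  then show ?case
    by (auto simp: S_cat_def intro: compose_restrict_left[OF semilattice_homs_PiE])
next
  case (5 A B D E f g h)
  then show ?case
    by (auto simp: S_cat_def intro: compose_assoc_PiE[OF semilattice_homs_PiE])
qed

lemma compose_distance_morphisms:
  assumes "(f, h) \<in> distance_morphisms \<delta> \<epsilon>" "(f', h') \<in> distance_morphisms \<epsilon> \<zeta>"
    and "distance \<delta>"
  shows "(compose (points \<delta>) f' f, compose (carrier (vals \<delta>)) h' h) \<in> distance_morphisms \<delta> \<zeta>"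
proof -
  interpret distance \<delta> by fact
  show ?thesis
    using assms(1,2) compose_semilattice_homs[OF _ _ vals_semilattice] dst_in_vals
    unfolding distance_morphisms_def
    by (auto simp: compose_def PiE_iff extensional_def)
qed

lemma restrict_id_distance_morphisms:
  assumes "distance \<delta>"
  shows "(restrict (\<lambda>x. x) (points \<delta>), restrict (\<lambda>x. x) (carrier (vals \<delta>)))
    \<in> distance_morphisms \<delta> \<delta>"
proof -
  interpret distance \<delta> by fact
  show ?thesis
    using restrict_id_semilattice_homs[OF vals_semilattice] dst_in_vals
    unfolding distance_morphisms_def by auto
qed

lemma distance_morphisms_PiE:
  "(f, h) \<in> distance_morphisms \<delta> \<epsilon> \<Longrightarrow>
    f \<in> points \<delta> \<rightarrow>\<^sub>E points \<epsilon> \<and> h \<in> carrier (vals \<delta>) \<rightarrow>\<^sub>E carrier (vals \<epsilon>)"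
  by (auto simp: distance_morphisms_def dest: semilattice_homs_PiE)

lemma category_D_cat: "category D_cat"
proof (unfold_locales, goal_cases)
  case (1 \<delta>)
  then show ?case
    by (auto simp: D_cat_def inj_on_def intro: restrict_id_distance_morphisms)
next
  case (2 \<delta> \<epsilon> \<zeta> f g)
  then show ?case
    by (cases f, cases g)
      (auto simp: D_cat_def intro: compose_distance_morphisms inj_on_compose_PiE
         dest: distance_morphisms_PiE[THEN conjunct1] distance_morphisms_PiE[THEN conjunct2])
next
  case (3 \<delta> \<epsilon> f)
  then show ?case
    by (cases f)
      (auto simp: D_cat_def compose_restrict_right dest!: distance_morphisms_PiE
         intro: compose_restrict_right)
next
  case (4 \<delta> \<epsilon> f)
  then show ?case
    by (cases f)
      (auto simp: D_cat_def dest!: distance_morphisms_PiE intro: compose_restrict_left)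
next
  case (5 \<delta> \<epsilon> \<zeta> \<xi> f g h)
  then show ?case
    by (cases f)
      (auto simp: D_cat_def dest!: distance_morphisms_PiE intro: compose_assoc_PiE)
qed

lemma category_D2_cat: "category D2_cat"
  unfolding D2_cat_def by (rule category_full_subcategory[OF category_D_cat])

lemma is_funct_forget: "is_funct D_cat S_cat forget"
  unfolding is_funct_def is_funct_axioms_def
  by (auto simp: category_D_cat category_S_cat)
    (auto simp: D_cat_def S_cat_def forget_def distance_morphisms_def)

lemma is_funct_forget_D2: "is_funct D2_cat S_cat forget"
proof -
  interpret F: is_funct D_cat S_cat forget by (rule is_funct_forget)
  interpret category D2_cat by (rule category_D2_cat)
  show ?thesis
    by unfold_locales
      (simp_all add: D2_cat_def full_subcategory_def F.FOb_in_Ob F.FAr_in_Hom F.FAr_Id F.FAr_Comp)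
qed

end

theory Submission
  imports Defs
begin

text \<open>
  Every distributive semilattice \<open>L\<close> carries the distance on its own elements that sends two
  distinct elements \<open>s\<close> and \<open>t\<close> to \<open>s \<squnion> t\<close>. It is surjective with trivial kernel, but usually
  violates the V-condition. The functor repairs this by freely adjoining witnesses.

  If \<open>d(x,y) = a \<squnion> b\<close>, adjoin a point \<open>z\<^sub>1\<close> at distance \<open>a\<close> from \<open>x\<close> and a point \<open>z\<^sub>2\<close> at distance
  \<open>a\<close> from \<open>y\<close>, put them at distance \<open>b\<close> from each other, and let every path from \<open>z\<^sub>1\<close> or \<open>z\<^sub>2\<close> to
  any old point go through \<open>x\<close> or \<open>y\<close> respectively. Going round the other way is never shorter:
  since \<open>d(x,u) \<le> a \<squnion> b \<squnion> d(y,u)\<close>, the detour from \<open>z\<^sub>1\<close> to \<open>u\<close> via \<open>z\<^sub>2\<close> and \<open>y\<close> costs at least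
  \<open>a \<squnion> d(x,u)\<close>. So no meets are required and old distances do not change. Distributivity
  enters exactly once (\<open>pdist_V_condition\<close>): it replaces a problem \<open>d(x,y) \<le> a \<squnion> b\<close> by one of the
  form \<open>d(x,y) = a' \<squnion> b'\<close> with \<open>a' \<le> a\<close> and \<open>b' \<le> b\<close>. When \<open>a'\<close> or \<open>b'\<close> is zero, old points
  already solve the problem, so points are adjoined only for nonzero \<open>a'\<close>, \<open>b'\<close>; this keeps the
  kernel trivial.

  Iterating gives a set of terms over \<open>L\<close>, the admissible points, in which all problems
  are solved. Terms make the construction visibly functorial: an embedding acts by renaming
  elements, and it preserves and reflects admissibility and distances because these are defined from
  \<open>\<squnion>\<close>, \<open>\<bottom>\<close> and equality alone (\<open>pdist_map_point\<close>, \<open>admissible_map_point_iff\<close>). An injection of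
  the terms into the infinite universe turns them into a set of the required type, and the
  composite with the forgetful functor is the identity on the nose.

  For directed colimits, the union of the images of the legs of a cocone in \<open>\<S>\<close> is again a
  distributive semilattice, so the universal property makes the legs of a colimit jointly
  surjective (\<open>colimit_is_union_of_images\<close>). A term mentions finitely many elements of \<open>L\<close>, hence
  comes from one object of the diagram; thus the legs between the spaces are jointly surjective on
  points too, and this forces the image cocone to be a colimit (\<open>colimit_D2_if_colimit_S\<close>).
\<close>

section \<open>Joins, sub-semilattices and embeddings\<close>

context join_semilattice_zero
begin

lemma join_le_iff:
  "\<lbrakk>x \<in> carrier L; y \<in> carrier L; z \<in> carrier L\<rbrakk> \<Longrightarrow> x \<squnion> y \<sqsubseteq> z \<longleftrightarrow> x \<sqsubseteq> z \<and> y \<sqsubseteq> z"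
  by (meson join_closed join_le join_left join_right le_trans)

text \<open>
  Identities between joins, and the triangle inequality below, are reduced to propositional logic
  by asking which \<open>c\<close> lie above both sides: being below \<open>c\<close> turns joins into conjunctions.
\<close>

lemma eq_if_same_upper_bounds:
  assumes "x \<in> carrier L" "y \<in> carrier L" "\<And>c. c \<in> carrier L \<Longrightarrow> x \<sqsubseteq> c \<longleftrightarrow> y \<sqsubseteq> c"
  shows "x = y"
  using assms by (meson le_antisym le_refl)

lemma join_eqI:
  assumes "x \<in> carrier L" "y \<in> carrier L" "s \<in> carrier L"
    and "\<And>c. c \<in> carrier L \<Longrightarrow> s \<sqsubseteq> c \<longleftrightarrow> x \<sqsubseteq> c \<and> y \<sqsubseteq> c"
  shows "x \<squnion> y = s"
  using assms by (intro eq_if_same_upper_bounds) (auto simp: join_le_iff)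

lemma le_iff_join: "\<lbrakk>x \<in> carrier L; y \<in> carrier L\<rbrakk> \<Longrightarrow> x \<sqsubseteq> y \<longleftrightarrow> x \<squnion> y = y"
  by (metis join_eqI join_left le_refl le_trans)

lemma le_bottom_iff: "x \<in> carrier L \<Longrightarrow> x \<sqsubseteq> \<bottom> \<longleftrightarrow> x = \<bottom>"
  by (meson bottom_closed bottom_lower le_antisym le_refl)

lemma join_bottom_left: "x \<in> carrier L \<Longrightarrow> \<bottom> \<squnion> x = x"
  by (meson bottom_closed bottom_lower le_iff_join)

lemma join_bottom_right: "x \<in> carrier L \<Longrightarrow> x \<squnion> \<bottom> = x"
  by (metis join_bottom_left join_comm)

lemma bottom_eqI: "\<lbrakk>z \<in> carrier L; \<And>x. x \<in> carrier L \<Longrightarrow> z \<sqsubseteq> x\<rbrakk> \<Longrightarrow> \<bottom> = z"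
  by (metis bottom_closed le_bottom_iff)

text \<open>
  The joins of a substructure are chosen by a description relative to the smaller carrier, so it takes
  an argument that they agree with the joins of \<open>L\<close>.
\<close>

lemma subsemilattice:
  assumes "M \<subseteq> carrier L" "\<bottom> \<in> M" "\<And>x y. \<lbrakk>x \<in> M; y \<in> M\<rbrakk> \<Longrightarrow> x \<squnion> y \<in> M"
  shows "join_semilattice_zero (L\<lparr>carrier := M\<rparr>)"
    and "\<bottom>\<^bsub>L\<lparr>carrier := M\<rparr>\<^esub> = \<bottom>"
    and "\<lbrakk>x \<in> M; y \<in> M\<rbrakk> \<Longrightarrow> x \<squnion>\<^bsub>L\<lparr>carrier := M\<rparr>\<^esub> y = x \<squnion> y"
proof -
  let ?M = "L\<lparr>carrier := M\<rparr>"
  have carr: "x \<in> carrier L" if "x \<in> M" for x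
    using assms(1) that by blast
  have po: "partial_order ?M"
  proof
    show "x \<sqsubseteq>\<^bsub>?M\<^esub> z"
      if "x \<sqsubseteq>\<^bsub>?M\<^esub> y" "y \<sqsubseteq>\<^bsub>?M\<^esub> z" "x \<in> carrier ?M" "y \<in> carrier ?M" "z \<in> carrier ?M"
      for x y z
      using that le_trans[of x y z] carr by simp
    show "x .=\<^bsub>?M\<^esub> y"
      if "x \<sqsubseteq>\<^bsub>?M\<^esub> y" "y \<sqsubseteq>\<^bsub>?M\<^esub> x" "x \<in> carrier ?M" "y \<in> carrier ?M" for x y
      using that le_antisym[of x y] carr eq_is_equal by simp
  qed (simp_all add: eq_is_equal carr)
  interpret M: partial_order ?M by (rule po)
  have join: "least ?M (x \<squnion> y) (Upper ?M {x, y})" if "x \<in> M" "y \<in> M" for x y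
    using that assms(3)[of x y] join_left[of x y] join_right[of x y] join_le[of x _ y] carr
    by (simp add: least_def Upper_def)
  have bot: "least ?M \<bottom> M"
    using assms by (auto simp: least_def subset_iff)
  show M: "join_semilattice_zero ?M"
    using join bot by unfold_locales auto
  interpret M: join_semilattice_zero ?M by (rule M)
  show "\<bottom>\<^bsub>?M\<^esub> = \<bottom>"
    using assms by (intro M.bottom_eqI) auto
  show "x \<squnion>\<^bsub>?M\<^esub> y = x \<squnion> y" if "x \<in> M" "y \<in> M"
    using that assms(1,3) by (intro M.join_eqI) (auto simp: subset_iff join_le_iff)
qed

end

lemma embedding_le_iff:
  assumes "join_semilattice_zero A" "join_semilattice_zero B"
    and "f \<in> semilattice_homs A B" "inj_on f (carrier A)" "x \<in> carrier A" "y \<in> carrier A"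
  shows "f x \<sqsubseteq>\<^bsub>B\<^esub> f y \<longleftrightarrow> x \<sqsubseteq>\<^bsub>A\<^esub> y"
proof -
  interpret A: join_semilattice_zero A by fact
  interpret B: join_semilattice_zero B by fact
  have "f x \<in> carrier B" "f y \<in> carrier B" "f (x \<squnion>\<^bsub>A\<^esub> y) = f x \<squnion>\<^bsub>B\<^esub> f y"
    using assms(3,5,6) by (auto simp: semilattice_homs_def)
  then show ?thesis
    using assms(4-6) by (metis A.join_closed A.le_iff_join B.le_iff_join inj_onD)
qed


section \<open>The freely generated points and their distance\<close>

text \<open>
  \<open>Near x y a b\<close> is the witness adjacent to \<open>x\<close> for the problem of splitting the distance from \<open>x\<close>
  to \<open>y\<close> as \<open>a\<close>, \<open>b\<close>, \<open>a\<close>. The witness adjacent to \<open>y\<close> is then \<open>Near y x a b\<close>, called its sibling,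
  so one constructor serves for both.
\<close>

datatype (elements: 'a) point =
    Base 'a
  | Near "'a point" "'a point" 'a 'a
  for map: map_point

primrec stage :: "'a point \<Rightarrow> nat" where
  "stage (Base s) = 0"
| "stage (Near x y a b) = Suc (max (stage x) (stage y))"

text \<open>
  From a witness to a point that is not its sibling and is of no later stage, one goes through the
  point next to the witness. Hence of two witnesses the one of the later stage is resolved first: the
  other one may be the sibling of the point next to it, and then the path need not pass through the
  point next to that other one. With equal stages either may go first.
\<close>

fun pdist :: "'a gorder \<Rightarrow> 'a point \<Rightarrow> 'a point \<Rightarrow> 'a" where
  "pdist L (Base s) (Base t) = (if s = t then \<bottom>\<^bsub>L\<^esub> else s \<squnion>\<^bsub>L\<^esub> t)"
| "pdist L (Base s) (Near x y a b) = a \<squnion>\<^bsub>L\<^esub> pdist L (Base s) x"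
| "pdist L (Near x y a b) (Base s) = a \<squnion>\<^bsub>L\<^esub> pdist L x (Base s)"
| "pdist L (Near x y a b) (Near x' y' a' b') =
    (if Near x y a b = Near x' y' a' b' then \<bottom>\<^bsub>L\<^esub>
     else if Near x' y' a' b' = Near y x a b then b
     else if stage (Near x' y' a' b') \<le> stage (Near x y a b)
       then a \<squnion>\<^bsub>L\<^esub> pdist L x (Near x' y' a' b')
     else a' \<squnion>\<^bsub>L\<^esub> pdist L (Near x y a b) x')"

text \<open>
  The admissible points are those adjoined for genuine problems. A witness with \<open>a = \<bottom>\<close> would lie
  at distance \<open>\<bottom>\<close> from the point next to it, and siblings with \<open>b = \<bottom>\<close> at distance \<open>\<bottom>\<close> from
  each other.
\<close>

fun admissible :: "'a gorder \<Rightarrow> 'a point \<Rightarrow> bool" where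
  "admissible L (Base s) \<longleftrightarrow> s \<in> carrier L"
| "admissible L (Near x y a b) \<longleftrightarrow>
    admissible L x \<and> admissible L y \<and> a \<in> carrier L \<and> b \<in> carrier L \<and>
    a \<noteq> \<bottom>\<^bsub>L\<^esub> \<and> b \<noteq> \<bottom>\<^bsub>L\<^esub> \<and> pdist L x y = a \<squnion>\<^bsub>L\<^esub> b"

lemma elements_admissible: "admissible L u \<Longrightarrow> elements u \<subseteq> carrier L"
  by (induction u) auto

lemma stage_eq_0: "stage u = 0 \<longleftrightarrow> (\<exists>s. u = Base s)"
  by (cases u) auto

lemma stage_map_point [simp]: "stage (map_point f u) = stage u"
  by (induction u) auto

lemma pdist_in_carrier:
  "\<lbrakk>join_semilattice_zero L; elements u \<subseteq> carrier L; elements v \<subseteq> carrier L\<rbrakk>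
    \<Longrightarrow> pdist L u v \<in> carrier L"
proof (induction L u v rule: pdist.induct)
  case (1 L s t)
  then interpret join_semilattice_zero L by simp
  show ?case using 1 by simp
next
  case (2 L s x y a b)
  then interpret join_semilattice_zero L by simp
  show ?case using 2 by simp
next
  case (3 L x y a b s)
  then interpret join_semilattice_zero L by simp
  show ?case using 3 by simp
next
  case (4 L x y a b x' y' a' b')
  then interpret join_semilattice_zero L by simp
  show ?case using 4 by auto
qed

context join_semilattice_zero
begin

lemma pdist_closed [simp]:
  "\<lbrakk>admissible L u; admissible L v\<rbrakk> \<Longrightarrow> pdist L u v \<in> carrier L"
  by (intro pdist_in_carrier join_semilattice_zero_axioms elements_admissible)

lemma pdist_self [simp]: "pdist L u u = \<bottom>"
  by (cases u) auto

text \<open>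
  Only \<open>x \<noteq> y\<close> has to be seen, as otherwise the two siblings would be the same point. But
  \<open>x = y\<close> gives \<open>a \<squnion> b = d(x,x) = \<bottom>\<close>.
\<close>

lemma pdist_sibling:
  "admissible L (Near x y a b) \<Longrightarrow> pdist L (Near x y a b) (Near y x a b) = b"
proof -
  assume adm: "admissible L (Near x y a b)"
  have "x \<noteq> y"
  proof
    assume "x = y"
    then have "a \<squnion> b = \<bottom>" using adm by simp
    then have "a \<sqsubseteq> \<bottom>" using adm join_left[of a b] by simp
    then show False using adm by (simp add: le_bottom_iff)
  qed
  then show ?thesis by simp
qed

lemma pdist_step_left:
  assumes "stage v \<le> stage (Near x y a b)" "v \<noteq> Near x y a b" "v \<noteq> Near y x a b"
  shows "pdist L (Near x y a b) v = a \<squnion> pdist L x v"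
proof (cases v)
  case (Near x' y' a' b')
  have "Near x y a b \<noteq> Near x' y' a' b'" "Near x' y' a' b' \<noteq> Near y x a b"
    "stage (Near x' y' a' b') \<le> stage (Near x y a b)"
    using assms unfolding Near by blast+
  then show ?thesis
    unfolding Near by (simp only: pdist.simps if_True if_False)
qed simp

lemma pdist_step_right:
  assumes "stage u < stage (Near x y a b)"
  shows "pdist L u (Near x y a b) = a \<squnion> pdist L u x"
proof (cases u)
  case (Near x' y' a' b')
  have "\<not> stage (Near x y a b) \<le> stage (Near x' y' a' b')"
    using assms unfolding Near by linarith
  moreover from this have "Near x' y' a' b' \<noteq> Near x y a b"
    by (metis order_refl)
  moreover have "Near x y a b \<noteq> Near y' x' a' b'"
    using assms unfolding Near by (auto simp: max.commute)
  ultimately show ?thesis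
    unfolding Near by (simp only: pdist.simps if_True if_False)
qed simp

text \<open>
  The definition resolves the first argument when the stages agree, so symmetry is not immediate:
  then both arguments are resolved one after the other, and the two orders give the same join.
\<close>

lemma pdist_commute:
  "\<lbrakk>admissible L u; admissible L v\<rbrakk> \<Longrightarrow> pdist L u v = pdist L v u"
proof (induction "stage u + stage v" arbitrary: u v rule: less_induct)
  case less
  have bigger: "pdist L u v = pdist L v u"
    if "stage v < stage u" "admissible L u" "admissible L v"
      and IH: "\<And>u' v'. \<lbrakk>stage u' + stage v' < stage u + stage v; admissible L u'; admissible L v'\<rbrakk>
                  \<Longrightarrow> pdist L u' v' = pdist L v' u'" for u v
  proof (cases u)
    case (Near x y a b)
    then have "pdist L u v = a \<squnion> pdist L x v"
      using that(1) by (auto intro!: pdist_step_left)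
    moreover have "pdist L v u = a \<squnion> pdist L v x"
      using that(1) Near by (simp add: pdist_step_right)
    moreover have "pdist L x v = pdist L v x"
      using that Near by auto
    ultimately show ?thesis by simp
  qed (use that in auto)
  consider "stage v < stage u" | "stage u < stage v" | "stage u = stage v" by linarith
  then show ?case
  proof cases
    case 1 then show ?thesis using bigger[of v u] less by auto
  next
    case 2 then show ?thesis using bigger[of u v] less by (auto simp: add.commute)
  next
    case 3
    show ?thesis
    proof (cases u)
      case (Base s)
      with 3 obtain t where "v = Base t" by (cases v) auto
      with Base show ?thesis by (auto simp: join_comm)
    next
      case u: (Near x y a b)
      with 3 obtain x' y' a' b' where v: "v = Near x' y' a' b'" by (cases v) auto
      have adm: "admissible L x" "admissible L x'" "a \<in> carrier L" "a' \<in> carrier L"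
        using less.prems u v by auto
      consider "u = v" | "v = Near y x a b" | "u \<noteq> v" "v \<noteq> Near y x a b" by blast
      then show ?thesis
      proof cases
        case 2
        then show ?thesis using pdist_sibling less.prems u by metis
      next
        case ne: 3
        have "pdist L u v = a \<squnion> pdist L x v"
          unfolding u using 3 ne u by (intro pdist_step_left) auto
        also have "pdist L x v = a' \<squnion> pdist L x x'"
          unfolding v using 3 u v by (intro pdist_step_right) auto
        finally have uv: "pdist L u v = a \<squnion> (a' \<squnion> pdist L x x')" .
        have "pdist L v u = a' \<squnion> pdist L x' u"
          unfolding v using 3 ne u v by (intro pdist_step_left) auto
        also have "pdist L x' u = a \<squnion> pdist L x' x"
          unfolding u using 3 u v by (intro pdist_step_right) auto
        also have "pdist L x' x = pdist L x x'"
          using less.hyps[of x' x] adm u v by simp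
        finally have vu: "pdist L v u = a' \<squnion> (a \<squnion> pdist L x x')" .
        show ?thesis
          unfolding uv vu
          by (rule eq_if_same_upper_bounds) (use adm in \<open>auto simp: join_le_iff\<close>)
      qed auto
    qed
  qed
qed

text \<open>
  The distance of distinct points is above a nonzero parameter of the later of the two, or, for two
  elements of \<open>L\<close>, above both of them.
\<close>

lemma pdist_eq_bottom_imp_eq:
  assumes "admissible L u" "admissible L v" "pdist L u v = \<bottom>"
  shows "u = v"
proof (rule ccontr)
  assume "u \<noteq> v"
  have step: False
    if "z = Near x y a b" "stage w \<le> stage z" "w \<noteq> z" "admissible L z" "admissible L w"
      and "pdist L z w = \<bottom>" for z w x y a b
  proof (cases "w = Near y x a b")
    case True
    then show False using that pdist_sibling by auto
  next
    case False
    then have "a \<squnion> pdist L x w = \<bottom>"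
      using that pdist_step_left by metis
    then show False
      using that join_left[of a "pdist L x w"] by (auto simp: le_bottom_iff)
  qed
  show False
  proof (cases "stage v \<le> stage u")
    case True
    show False
    proof (cases u)
      case (Base s)
      with True obtain t where "v = Base t" by (cases v) auto
      with Base \<open>u \<noteq> v\<close> assms have "s \<noteq> t" "s \<squnion> t = \<bottom>" "s \<in> carrier L" "t \<in> carrier L"
        by auto
      then show False
        using join_le_iff[of s t \<bottom>] by (auto simp: le_bottom_iff)
    next
      case (Near x y a b)
      then show False using step True \<open>u \<noteq> v\<close> assms by blast
    qed
  next
    case False
    then obtain x y a b where "v = Near x y a b" by (cases v) auto
    then show False
      using step[of v x y a b u] False \<open>u \<noteq> v\<close> assms pdist_commute by auto
  qed
qed

text \<open>
  All three triangle inequalities for \<open>u\<close>, \<open>v\<close>, \<open>w\<close>, tested against one upper bound \<open>c\<close>. Bundling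
  the three makes the condition symmetric, so that a proof may assume which point has the latest
  stage.
\<close>

definition triangle :: "'s \<Rightarrow> 's point \<Rightarrow> 's point \<Rightarrow> 's point \<Rightarrow> bool" where
  "triangle c u v w \<longleftrightarrow>
    (pdist L u v \<sqsubseteq> c \<and> pdist L v w \<sqsubseteq> c \<longrightarrow> pdist L u w \<sqsubseteq> c) \<and>
    (pdist L u w \<sqsubseteq> c \<and> pdist L v w \<sqsubseteq> c \<longrightarrow> pdist L u v \<sqsubseteq> c) \<and>
    (pdist L u v \<sqsubseteq> c \<and> pdist L u w \<sqsubseteq> c \<longrightarrow> pdist L v w \<sqsubseteq> c)"

lemma triangle_rotate:
  assumes "admissible L u" "admissible L v" "admissible L w" "triangle c u v w"
  shows "triangle c v w u"
  using assms(4) pdist_commute[OF assms(1,2)] pdist_commute[OF assms(1,3)]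
  unfolding triangle_def by metis

lemma triangle_swap:
  assumes "admissible L u" "admissible L v" "admissible L w" "triangle c u v w"
  shows "triangle c u w v"
  using assms(4) pdist_commute[OF assms(2,3)] unfolding triangle_def by metis

text \<open>
  Replacing \<open>x\<close> by a witness next to it adds the condition \<open>a \<sqsubseteq> c\<close> to both distances from that corner.
  Every inequality with one of them as conclusion has the other one among its premises.
\<close>

lemma triangle_step:
  assumes "z = Near x y a b" "stage v \<le> stage z" "stage w \<le> stage z"
    and "v \<noteq> z" "w \<noteq> z" "v \<noteq> Near y x a b" "w \<noteq> Near y x a b"
    and "admissible L z" "admissible L v" "admissible L w" "c \<in> carrier L"
    and "triangle c x v w"
  shows "triangle c z v w"
proof -
  have "pdist L z v = a \<squnion> pdist L x v"
    using assms(2,4,6) unfolding assms(1) by (rule pdist_step_left)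
  moreover have "pdist L z w = a \<squnion> pdist L x w"
    using assms(3,5,7) unfolding assms(1) by (rule pdist_step_left)
  moreover have "admissible L x" "a \<in> carrier L"
    using assms(1,8) by simp_all
  ultimately have "pdist L z v \<sqsubseteq> c \<longleftrightarrow> a \<sqsubseteq> c \<and> pdist L x v \<sqsubseteq> c"
    "pdist L z w \<sqsubseteq> c \<longleftrightarrow> a \<sqsubseteq> c \<and> pdist L x w \<sqsubseteq> c"
    using assms(9-11) by (simp_all add: join_le_iff)
  then show ?thesis
    using assms(12) unfolding triangle_def by blast
qed

text \<open>
  This is where \<open>d(x,y) = a \<squnion> b\<close> is needed: from it, \<open>b\<close> is below any bound for a path from \<open>z\<close> to
  \<open>z'\<close> through \<open>x\<close>, \<open>w\<close> and \<open>y\<close>, and the path from \<open>z\<close> to \<open>w\<close> through \<open>z'\<close> and \<open>y\<close> costs at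
  least as much as the direct one through \<open>x\<close>.
\<close>

lemma triangle_siblings:
  assumes z: "z = Near x y a b" "z' = Near y x a b" and "stage w < stage z"
    and "admissible L z" "admissible L z'" "admissible L w" "c \<in> carrier L"
    and "triangle c x y w"
  shows "triangle c z z' w"
proof -
  have ne: "w \<noteq> z" "w \<noteq> z'" "stage w \<le> stage z" "stage w \<le> stage z'"
    using assms(1-3) by auto
  have "pdist L z w = a \<squnion> pdist L x w" "pdist L z' w = a \<squnion> pdist L y w"
    using pdist_step_left[of w x y a b] pdist_step_left[of w y x a b] ne unfolding z by blast+
  moreover have "pdist L z z' = b"
    using assms(4) pdist_sibling unfolding z by blast
  moreover have "pdist L x y = a \<squnion> b" "admissible L x" "admissible L y"
    "a \<in> carrier L" "b \<in> carrier L"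
    using assms(4) unfolding z by simp_all
  ultimately have "pdist L z w \<sqsubseteq> c \<longleftrightarrow> a \<sqsubseteq> c \<and> pdist L x w \<sqsubseteq> c"
    "pdist L z' w \<sqsubseteq> c \<longleftrightarrow> a \<sqsubseteq> c \<and> pdist L y w \<sqsubseteq> c"
    "pdist L z z' \<sqsubseteq> c \<longleftrightarrow> b \<sqsubseteq> c" "pdist L x y \<sqsubseteq> c \<longleftrightarrow> a \<sqsubseteq> c \<and> b \<sqsubseteq> c"
    using assms(6,7) by (simp_all add: join_le_iff)
  then show ?thesis
    using assms(8) unfolding triangle_def by blast
qed

text \<open>
  By induction on the sum of the stages. Distinct elements of \<open>L\<close> are at distance their join, and then
  the claim is plain. Beyond stage \<open>0\<close>, a corner of the latest stage whose sibling is not a corner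
  is moved to an earlier stage by \<open>triangle_step\<close>. Otherwise two corners are siblings, and the third
  one, whose sibling cannot be a corner as well, is either movable or of an earlier stage; in the
  latter case \<open>triangle_siblings\<close> applies.
\<close>

lemma triangle_admissible:
  assumes c: "c \<in> carrier L"
  shows "\<lbrakk>admissible L u; admissible L v; admissible L w\<rbrakk> \<Longrightarrow> triangle c u v w"
proof (induction "stage u + stage v + stage w" arbitrary: u v w rule: less_induct)
  case less
  note IH = less.hyps
  have largest: "triangle c p q r"
    if le: "stage q \<le> stage p" "stage r \<le> stage p"
      and sz: "stage p + stage q + stage r = stage u + stage v + stage w"
      and adm: "admissible L p" "admissible L q" "admissible L r" for p q r
  proof (cases "p = q \<or> p = r \<or> q = r")
    case True
    then show ?thesis
      using c pdist_commute[OF adm(1,2)] bottom_lower pdist_self unfolding triangle_def by metis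
  next
    case distinct: False
    have siblings: "triangle c p q' r'"
      if p: "p = Near x y a b" and q': "q' = Near y x a b"
        and sz': "stage p + stage q' + stage r' = stage u + stage v + stage w" "stage r' \<le> stage p"
        and adm': "admissible L q'" "admissible L r'" and ne: "r' \<noteq> p" "r' \<noteq> q'"
      for x y a b q' r'
    proof (cases "stage r' = stage p")
      \<comment> \<open>The sibling of \<open>r'\<close> is neither \<open>p\<close> nor \<open>q'\<close>, these being siblings of each other.\<close>
      case True
      then obtain x' y' a' b' where r': "r' = Near x' y' a' b'" using p by (cases r') auto
      then have parent: "stage x' < stage r'" "admissible L x'"
        using adm'(2) by simp_all
      have "triangle c x' p q'"
        using parent sz'(1) adm(1) adm'(1) by (intro IH) simp_all
      moreover have "stage q' = stage p" "p \<noteq> Near y' x' a' b'" "q' \<noteq> Near y' x' a' b'"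
        using ne p q' r' by auto
      ultimately have "triangle c r' p q'"
        using True ne c adm(1) adm' by (intro triangle_step[OF r']) auto
      then show ?thesis
        using adm adm' triangle_rotate by blast
    next
      case False
      have parents: "stage x < stage p" "stage y < stage q'" "admissible L x" "admissible L y"
        using adm(1) p q' by simp_all
      have "triangle c x y r'"
        using parents sz'(1) adm'(2) by (intro IH) simp_all
      moreover have "stage r' < stage p"
        using False sz'(2) by simp
      ultimately show ?thesis
        using adm(1) adm' c by (intro triangle_siblings[OF p q'])
    qed
    show ?thesis
    proof (cases p)
      \<comment> \<open>As the latest stage is \<open>0\<close>, all three points are elements of \<open>L\<close>.\<close>
      case p: (Base s)
      with le obtain t t' where "q = Base t" "r = Base t'"
        using stage_eq_0[of q] stage_eq_0[of r] by auto
      with p distinct have *: "p = Base s" "q = Base t" "r = Base t'" "s \<noteq> t" "s \<noteq> t'" "t \<noteq> t'"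
        by blast+
      have "s \<in> carrier L" "t \<in> carrier L" "t' \<in> carrier L"
        using adm unfolding *(1-3) by simp_all
      then show ?thesis
        using *(4-6) c unfolding triangle_def *(1-3) by (simp add: join_le_iff)
    next
      case p: (Near x y a b)
      consider "q = Near y x a b" | "r = Near y x a b"
        | "q \<noteq> Near y x a b" "r \<noteq> Near y x a b" by blast
      then show ?thesis
      proof cases
        case 1
        with siblings[OF p] show ?thesis using le sz adm distinct by metis
      next
        case 2
        moreover have "stage p + stage r + stage q = stage u + stage v + stage w"
          using sz by simp
        ultimately have "triangle c p r q"
          using siblings[OF p] le adm distinct by metis
        then show ?thesis using adm triangle_swap by blast
      next
        case 3
        have parent: "stage x < stage p" "admissible L x"
          using adm(1) p by simp_all
        have "triangle c x q r"
          using parent sz adm by (intro IH) simp_all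
        then show ?thesis
          using 3 le distinct adm c by (intro triangle_step[OF p]) blast+
      qed
    qed
  qed
  consider "stage v \<le> stage u" "stage w \<le> stage u" | "stage u \<le> stage v" "stage w \<le> stage v"
    | "stage u \<le> stage w" "stage v \<le> stage w" by linarith
  then show ?case
  proof cases
    case 1
    then show ?thesis using largest less.prems by simp
  next
    case 2
    then have "triangle c v w u" using largest less.prems by simp
    then show ?thesis using triangle_rotate less.prems by blast
  next
    case 3
    then have "triangle c w u v" using largest less.prems by simp
    then show ?thesis using triangle_rotate less.prems by blast
  qed
qed

lemma pdist_triangle:
  assumes "admissible L u" "admissible L v" "admissible L w"
  shows "pdist L u w \<sqsubseteq> pdist L u v \<squnion> pdist L v w"
proof -
  have "triangle (pdist L u v \<squnion> pdist L v w) u v w"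
    using assms by (intro triangle_admissible) simp_all
  then show ?thesis
    using assms unfolding triangle_def by (metis join_left join_right pdist_closed)
qed

end

lemma (in distributive_semilattice) pdist_V_condition:
  assumes xy: "admissible L x" "admissible L y" and ab: "a \<in> carrier L" "b \<in> carrier L"
    and le: "pdist L x y \<sqsubseteq> a \<squnion> b"
  shows "\<exists>z1 z2. admissible L z1 \<and> admissible L z2 \<and>
    pdist L x z1 \<sqsubseteq> a \<and> pdist L z1 z2 \<sqsubseteq> b \<and> pdist L z2 y \<sqsubseteq> a"
proof -
  obtain a' b' where a'b': "a' \<in> carrier L" "b' \<in> carrier L" "a' \<sqsubseteq> a" "b' \<sqsubseteq> b"
    and eq: "pdist L x y = a' \<squnion> b'"
    using distributive[OF ab _ le] xy by auto
  consider "a' = \<bottom>" | "b' = \<bottom>" | "a' \<noteq> \<bottom>" "b' \<noteq> \<bottom>" by blast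
  then show ?thesis
  proof cases
    case 1
    with eq a'b' have "pdist L x y \<sqsubseteq> b" by (simp add: join_bottom_left)
    then show ?thesis using xy ab by (intro exI[of _ x] exI[of _ y]) simp
  next
    case 2
    with eq a'b' have "pdist L x y \<sqsubseteq> a" by (simp add: join_bottom_right)
    then show ?thesis using xy ab by (intro exI[of _ x]) simp
  next
    case 3
    let ?z1 = "Near x y a' b'" and ?z2 = "Near y x a' b'"
    have adm: "admissible L ?z1" "admissible L ?z2"
      using 3 xy a'b' eq pdist_commute[OF xy] by simp_all
    have "pdist L x ?z1 = a'" "pdist L y ?z2 = a'"
      using a'b' by (simp_all add: pdist_step_right join_bottom_right)
    moreover have "pdist L ?z2 y = pdist L y ?z2"
      using adm(2) xy(2) by (rule pdist_commute)
    ultimately show ?thesis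
      using a'b' adm pdist_sibling[OF adm(1)] by metis
  qed
qed


section \<open>Embeddings act on points\<close>

lemma map_point_eq_iff:
  assumes "inj_on f S" "elements u \<subseteq> S" "elements v \<subseteq> S"
  shows "map_point f u = map_point f v \<longleftrightarrow> u = v"
  using assms point.inj_map_strong[of u v f f] by (metis inj_onD subsetD)

text \<open>
  Injectivity of \<open>f\<close> on the elements ensures that renaming neither identifies distinct points nor
  creates new siblings, so both sides take the same branch of the definition of the distance.
\<close>

lemma pdist_map_point:
  "\<lbrakk>join_semilattice_zero A; f \<in> semilattice_homs A B; inj_on f (carrier A);
    elements u \<subseteq> carrier A; elements v \<subseteq> carrier A\<rbrakk>
    \<Longrightarrow> pdist B (map_point f u) (map_point f v) = f (pdist A u v)"
proof (induction A u v rule: pdist.induct)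
  case (1 A s t)
  then have "f s = f t \<longleftrightarrow> s = t" by (auto dest: inj_onD)
  with 1 show ?case by (auto simp: semilattice_homs_def)
next
  case (2 A s x y a b)
  then have "pdist A (Base s) x \<in> carrier A" by (intro pdist_in_carrier) simp_all
  with 2 show ?case by (simp add: semilattice_homs_def)
next
  case (3 A x y a b s)
  then have "pdist A x (Base s) \<in> carrier A" by (intro pdist_in_carrier) simp_all
  with 3 show ?case by (simp add: semilattice_homs_def)
next
  case (4 A x y a b x' y' a' b')
  let ?z = "Near x y a b" and ?z' = "Near x' y' a' b'" and ?s = "Near y x a b"
  have hom: "f \<bottom>\<^bsub>A\<^esub> = \<bottom>\<^bsub>B\<^esub>"
    "\<And>s t. \<lbrakk>s \<in> carrier A; t \<in> carrier A\<rbrakk> \<Longrightarrow> f (s \<squnion>\<^bsub>A\<^esub> t) = f s \<squnion>\<^bsub>B\<^esub> f t"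
    using 4(4) by (auto simp: semilattice_homs_def)
  have elems: "elements x \<subseteq> carrier A" "elements x' \<subseteq> carrier A" "elements ?s \<subseteq> carrier A"
    "a \<in> carrier A" "a' \<in> carrier A"
    using 4(6,7) by auto
  have eq: "map_point f ?z = map_point f ?z' \<longleftrightarrow> ?z = ?z'"
    "map_point f ?z' = map_point f ?s \<longleftrightarrow> ?z' = ?s"
    using 4(5-7) elems by - (rule map_point_eq_iff; assumption)+
  have closed: "pdist A x ?z' \<in> carrier A" "pdist A ?z x' \<in> carrier A"
    using 4(3,6,7) elems by - (rule pdist_in_carrier; assumption)+
  have stage: "stage (map_point f ?z') \<le> stage (map_point f ?z) \<longleftrightarrow> stage ?z' \<le> stage ?z"
    by (simp only: stage_map_point)
  note unfolded = pdist.simps(4)[of B "map_point f x" "map_point f y" "f a" "f b"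
      "map_point f x'" "map_point f y'" "f a'" "f b'",
      folded point.map(2), unfolded eq stage]
  consider "?z = ?z'" | "?z \<noteq> ?z'" "?z' = ?s" | "?z \<noteq> ?z'" "?z' \<noteq> ?s" "stage ?z' \<le> stage ?z"
    | "?z \<noteq> ?z'" "?z' \<noteq> ?s" "\<not> stage ?z' \<le> stage ?z" by blast
  then show ?case
  proof cases
    case 1
    show ?thesis unfolding unfolded pdist.simps(4)[of A] if_P[OF 1] by (rule hom(1)[symmetric])
  next
    case 2
    show ?thesis
      unfolding unfolded pdist.simps(4)[of A] if_not_P[OF 2(1)] if_P[OF 2(2)] by (rule refl)
  next
    case 3
    then have "pdist B (map_point f x) (map_point f ?z') = f (pdist A x ?z')"
      using 4 elems by blast
    with 3 show ?thesis
      unfolding unfolded pdist.simps(4)[of A] using hom(2)[OF elems(4) closed(1)]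
      by (simp only: if_True if_False)
  next
    case 4
    then have "pdist B (map_point f ?z) (map_point f x') = f (pdist A ?z x')"
      using "4.IH"(2) "4.prems" elems by blast
    with 4 show ?thesis
      unfolding unfolded pdist.simps(4)[of A] using hom(2)[OF elems(5) closed(2)]
      by (simp only: if_True if_False)
  qed
qed

text \<open>
  The reflection of admissibility is what lets a point over a directed colimit be
  pulled back to a point over an object of the diagram.
\<close>

lemma admissible_map_point_iff:
  assumes A: "join_semilattice_zero A" and B: "join_semilattice_zero B"
    and f: "f \<in> semilattice_homs A B" and inj: "inj_on f (carrier A)"
  shows "elements u \<subseteq> carrier A \<Longrightarrow> admissible B (map_point f u) \<longleftrightarrow> admissible A u"
proof (induction u)
  case (Base s)
  then show ?case using f by (auto simp: semilattice_homs_def)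
next
  case (Near x y a b)
  interpret A: join_semilattice_zero A by (rule A)
  have elems: "elements x \<subseteq> carrier A" "elements y \<subseteq> carrier A"
    and ab: "a \<in> carrier A" "b \<in> carrier A"
    using Near.prems by auto
  have "f a \<in> carrier B" "f b \<in> carrier B"
    using f ab by (auto simp: semilattice_homs_def)
  moreover have "f s = \<bottom>\<^bsub>B\<^esub> \<longleftrightarrow> s = \<bottom>\<^bsub>A\<^esub>" if "s \<in> carrier A" for s
    using inj_onD[OF inj, of s "\<bottom>\<^bsub>A\<^esub>"] f that by (auto simp: semilattice_homs_def)
  moreover have "pdist B (map_point f x) (map_point f y) = f a \<squnion>\<^bsub>B\<^esub> f b \<longleftrightarrow>
    pdist A x y = a \<squnion>\<^bsub>A\<^esub> b"
  proof -
    have "pdist A x y \<in> carrier A" using A elems by (rule pdist_in_carrier)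
    moreover have "f a \<squnion>\<^bsub>B\<^esub> f b = f (a \<squnion>\<^bsub>A\<^esub> b)"
      using f ab by (simp add: semilattice_homs_def)
    moreover have "pdist B (map_point f x) (map_point f y) = f (pdist A x y)"
      using A f inj elems by (rule pdist_map_point)
    ultimately show ?thesis
      using inj ab by (metis A.join_closed inj_onD)
  qed
  ultimately show ?case
    using Near.IH elems ab by simp
qed


section \<open>The functor\<close>

text \<open>
  Both the points and the values of an object of \<open>\<D>\<^sub>2\<close> come from prescribed types, so the admissible
  points are coded by an injection \<open>e\<close>.
\<close>

definition generated_space :: "('a point \<Rightarrow> 'x) \<Rightarrow> 'a gorder \<Rightarrow> ('x, 'a) distance_space" where
  "generated_space e A =
    \<lparr>points = e ` {u. admissible A u}, vals = A, dst = (\<lambda>p q. pdist A (inv e p) (inv e q))\<rparr>"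

definition generated_functor ::
  "('a point \<Rightarrow> 'a) \<Rightarrow> ('a gorder, 'a \<Rightarrow> 'a, ('a, 'a) distance_space, ('a \<Rightarrow> 'a) \<times> ('a \<Rightarrow> 'a)) funct"
where
  "generated_functor e =
    \<lparr>FOb = generated_space e,
     FAr = (\<lambda>A B f. (restrict (\<lambda>p. e (map_point f (inv e p))) (points (generated_space e A)), f))\<rparr>"

lemma generated_space_simps [simp]:
  "points (generated_space e A) = e ` {u. admissible A u}"
  "vals (generated_space e A) = A"
  "inj e \<Longrightarrow> dst (generated_space e A) (e u) (e v) = pdist A u v"
  by (simp_all add: generated_space_def)

lemma Ob_S_cat: "A \<in> Ob S_cat \<longleftrightarrow> distributive_semilattice A"
  by (simp add: S_cat_def)

lemma Hom_S_cat: "f \<in> Hom S_cat A B \<longleftrightarrow> f \<in> semilattice_homs A B \<and> inj_on f (carrier A)"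
  by (simp add: S_cat_def)

lemma Comp_S_cat: "Comp S_cat A B C g f = compose (carrier A) g f"
  by (simp add: S_cat_def)

lemma Ob_D2_cat:
  "\<delta> \<in> Ob D2_cat \<longleftrightarrow> distance \<delta> \<and> surjective_distance \<delta> \<and>
    distance_kernel \<delta> = Id_on (points \<delta>) \<and> distributive_semilattice (vals \<delta>) \<and>
    V_distance_type2 \<delta>"
  by (auto simp: D2_cat_def full_subcategory_def D_cat_def)

lemma Hom_D2_cat:
  "(f, h) \<in> Hom D2_cat \<delta> \<epsilon> \<longleftrightarrow> (f, h) \<in> distance_morphisms \<delta> \<epsilon> \<and>
    inj_on f (points \<delta>) \<and> inj_on h (carrier (vals \<delta>))"
  by (auto simp: D2_cat_def full_subcategory_def D_cat_def)

lemma Hom_D2_catD: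
  assumes "q \<in> Hom D2_cat \<delta> \<epsilon>"
  shows "fst q \<in> points \<delta> \<rightarrow>\<^sub>E points \<epsilon>" "snd q \<in> semilattice_homs (vals \<delta>) (vals \<epsilon>)"
    "\<lbrakk>x \<in> points \<delta>; y \<in> points \<delta>\<rbrakk> \<Longrightarrow> snd q (dst \<delta> x y) = dst \<epsilon> (fst q x) (fst q y)"
    "inj_on (fst q) (points \<delta>)" "inj_on (snd q) (carrier (vals \<delta>))"
  using assms by (cases q; simp add: Hom_D2_cat distance_morphisms_def)+

lemma Comp_D2_cat:
  "Comp D2_cat \<delta> \<epsilon> \<zeta> g f =
    (compose (points \<delta>) (fst g) (fst f), compose (carrier (vals \<delta>)) (snd g) (snd f))"
  by (simp add: D2_cat_def full_subcategory_def D_cat_def)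

lemma Id_D2_cat:
  "Id D2_cat \<delta> = (restrict (\<lambda>x. x) (points \<delta>), restrict (\<lambda>x. x) (carrier (vals \<delta>)))"
  by (simp add: D2_cat_def full_subcategory_def D_cat_def)

lemma generated_space_in_D2:
  assumes A: "distributive_semilattice A" and e: "inj e"
  shows "generated_space e A \<in> Ob D2_cat"
proof -
  interpret distributive_semilattice A by (rule A)
  let ?\<delta> = "generated_space e A"
  have dist: "distance ?\<delta>"
  proof (rule distance.intro)
    show "dst ?\<delta> p r \<sqsubseteq>\<^bsub>vals ?\<delta>\<^esub> dst ?\<delta> p q \<squnion>\<^bsub>vals ?\<delta>\<^esub> dst ?\<delta> q r"
      if "p \<in> points ?\<delta>" "q \<in> points ?\<delta>" "r \<in> points ?\<delta>" for p q r
      using that e by (auto intro: pdist_triangle)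
    show "dst ?\<delta> p q = dst ?\<delta> q p" if "p \<in> points ?\<delta>" "q \<in> points ?\<delta>" for p q
      using that e by (auto intro: pdist_commute)
    show "join_semilattice_zero (vals ?\<delta>)"
      using join_semilattice_zero_axioms by simp
  qed (use e in auto)
  have surj: "surjective_distance ?\<delta>"
    unfolding surjective_distance_def
  proof (intro equalityI subsetI)
    fix s assume "s \<in> carrier (vals ?\<delta>)"
    then have s: "s \<in> carrier A" by simp
    \<comment> \<open>For \<open>s = \<bottom>\<close> too: then this is the distance of a point from itself.\<close>
    then have "s = dst ?\<delta> (e (Base s)) (e (Base \<bottom>\<^bsub>A\<^esub>))"
      using e by (simp add: join_bottom_right)
    moreover have "(e (Base s), e (Base \<bottom>\<^bsub>A\<^esub>)) \<in> points ?\<delta> \<times> points ?\<delta>"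
      using s by simp
    ultimately show "s \<in> (\<lambda>(x, y). dst ?\<delta> x y) ` (points ?\<delta> \<times> points ?\<delta>)"
      by (metis (mono_tags, lifting) case_prod_conv image_eqI)
  qed (use e in auto)
  have kernel: "distance_kernel ?\<delta> = Id_on (points ?\<delta>)"
    using e by (auto simp: distance_kernel_def Id_on_def dest: pdist_eq_bottom_imp_eq)
  have V: "V_distance_type2 ?\<delta>"
    unfolding V_distance_type2_def
  proof (intro conjI ballI impI)
    fix p q a b
    assume p: "p \<in> points ?\<delta>" and q: "q \<in> points ?\<delta>" and a: "a \<in> carrier (vals ?\<delta>)"
      and b: "b \<in> carrier (vals ?\<delta>)"
      and le: "dst ?\<delta> p q \<sqsubseteq>\<^bsub>vals ?\<delta>\<^esub> a \<squnion>\<^bsub>vals ?\<delta>\<^esub> b"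
    obtain x y where x: "p = e x" "admissible A x" and y: "q = e y" "admissible A y"
      using p q by auto
    obtain z1 z2 where "admissible A z1" "admissible A z2"
      "pdist A x z1 \<sqsubseteq>\<^bsub>A\<^esub> a" "pdist A z1 z2 \<sqsubseteq>\<^bsub>A\<^esub> b" "pdist A z2 y \<sqsubseteq>\<^bsub>A\<^esub> a"
      using pdist_V_condition[of x y a b] x y a b le e by auto
    then show "\<exists>z1\<in>points ?\<delta>. \<exists>z2\<in>points ?\<delta>. dst ?\<delta> p z1 \<sqsubseteq>\<^bsub>vals ?\<delta>\<^esub> a \<and>
        dst ?\<delta> z1 z2 \<sqsubseteq>\<^bsub>vals ?\<delta>\<^esub> b \<and> dst ?\<delta> z2 q \<sqsubseteq>\<^bsub>vals ?\<delta>\<^esub> a"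
      using x y e by (intro bexI[of _ "e z1"] bexI[of _ "e z2"]) auto
  qed (rule dist)
  show ?thesis
    using dist surj kernel V A by (simp add: Ob_D2_cat)
qed

lemma generated_functor_in_Hom:
  assumes A: "distributive_semilattice A" and B: "distributive_semilattice B"
    and f: "f \<in> Hom S_cat A B" and e: "inj e"
  shows "FAr (generated_functor e) A B f \<in> Hom D2_cat (generated_space e A) (generated_space e B)"
proof -
  have sl: "join_semilattice_zero A" "join_semilattice_zero B"
    using A B by (simp_all add: distributive_semilattice_join_semilattice_zero)
  have hom: "f \<in> semilattice_homs A B" and inj: "inj_on f (carrier A)"
    using f by (simp_all add: Hom_S_cat)
  have adm: "admissible B (map_point f u)" if "admissible A u" for u
    using that admissible_map_point_iff[OF sl hom inj] elements_admissible by blast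
  have eq: "map_point f u = map_point f v \<longleftrightarrow> u = v" if "admissible A u" "admissible A v" for u v
    using inj that[THEN elements_admissible] by (rule map_point_eq_iff)
  have dist: "pdist B (map_point f u) (map_point f v) = f (pdist A u v)"
    if "admissible A u" "admissible A v" for u v
    using sl(1) hom inj that[THEN elements_admissible] by (rule pdist_map_point)
  let ?g = "restrict (\<lambda>p. e (map_point f (inv e p))) (points (generated_space e A))"
  have g: "?g (e u) = e (map_point f u)" if "admissible A u" for u
    using that e by simp
  have points: "p \<in> points (generated_space e A) \<longleftrightarrow> (\<exists>u. admissible A u \<and> p = e u)" for p A
    by auto
  have "?g \<in> points (generated_space e A) \<rightarrow>\<^sub>E points (generated_space e B)"
  proof (rule PiE_I)
    fix p assume "p \<in> points (generated_space e A)"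
    then obtain u where "admissible A u" "p = e u" unfolding points by blast
    then show "?g p \<in> points (generated_space e B)"
      using g adm unfolding points by metis
  qed simp
  moreover have "f (dst (generated_space e A) p q) = dst (generated_space e B) (?g p) (?g q)"
    if pq: "p \<in> points (generated_space e A)" "q \<in> points (generated_space e A)" for p q
  proof -
    obtain u v where uv: "admissible A u" "p = e u" "admissible A v" "q = e v"
      using pq unfolding points by blast
    show ?thesis
      unfolding uv(2,4) g[OF uv(1)] g[OF uv(3)] generated_space_simps(3)[OF e]
      using dist[OF uv(1,3)] by simp
  qed
  moreover have "inj_on ?g (points (generated_space e A))"
  proof (rule inj_onI)
    fix p q
    assume pq: "p \<in> points (generated_space e A)" "q \<in> points (generated_space e A)"
      and "?g p = ?g q"
    obtain u v where uv: "admissible A u" "p = e u" "admissible A v" "q = e v"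
      using pq unfolding points by blast
    have "e (map_point f u) = e (map_point f v)"
      using \<open>?g p = ?g q\<close> unfolding uv(2,4) g[OF uv(1)] g[OF uv(3)] .
    then show "p = q"
      using eq[OF uv(1,3)] e uv(2,4) by (simp add: inj_eq)
  qed
  ultimately show ?thesis
    using hom inj
    by (simp only: generated_functor_def funct.simps Hom_D2_cat distance_morphisms_def
        generated_space_simps mem_Collect_eq case_prod_conv simp_thms) blast
qed

lemma is_funct_generated_functor:
  assumes e: "inj e"
  shows "is_funct S_cat D2_cat (generated_functor e)"
proof (intro is_funct.intro is_funct_axioms.intro category_S_cat category_D2_cat)
  let ?\<Phi> = "generated_functor e"
  show "FOb ?\<Phi> A \<in> Ob D2_cat" if "A \<in> Ob S_cat" for A
    using that e generated_space_in_D2 by (simp add: generated_functor_def Ob_S_cat)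
  show "FAr ?\<Phi> A B f \<in> Hom D2_cat (FOb ?\<Phi> A) (FOb ?\<Phi> B)"
    if "A \<in> Ob S_cat" "B \<in> Ob S_cat" "f \<in> Hom S_cat A B" for A B f
    using that generated_functor_in_Hom[of A B f e] e
    by (simp add: Ob_S_cat generated_functor_def)
  have map_id: "map_point (restrict (\<lambda>s. s) (carrier A)) u = u" if "admissible A u" for A and u :: "'a point"
    using elements_admissible[OF that] by (intro trans[OF point.map_cong point.map_ident]) auto
  show "FAr ?\<Phi> A A (Id S_cat A) = Id D2_cat (FOb ?\<Phi> A)" if "A \<in> Ob S_cat" for A
    using e by (auto simp: generated_functor_def Id_D2_cat S_cat_def map_id intro!: restrict_ext)
  show "FAr ?\<Phi> A D (Comp S_cat A B D g f) =
      Comp D2_cat (FOb ?\<Phi> A) (FOb ?\<Phi> B) (FOb ?\<Phi> D) (FAr ?\<Phi> B D g) (FAr ?\<Phi> A B f)"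
    if A: "A \<in> Ob S_cat" and B: "B \<in> Ob S_cat" and D: "D \<in> Ob S_cat"
      and f: "f \<in> Hom S_cat A B" and g: "g \<in> Hom S_cat B D" for A B D f g
  proof -
    have sl: "join_semilattice_zero A" "join_semilattice_zero B"
      using A B by (simp_all add: Ob_S_cat distributive_semilattice_join_semilattice_zero)
    have hom: "f \<in> semilattice_homs A B" and inj: "inj_on f (carrier A)"
      using f by (simp_all add: Hom_S_cat)
    have adm: "admissible B (map_point f u)" if "admissible A u" for u
      using that admissible_map_point_iff[OF sl hom inj] elements_admissible by blast
    have comp: "map_point (compose (carrier A) g f) u = map_point g (map_point f u)"
      if "admissible A u" for u
      unfolding point.map_comp
      using elements_admissible[OF that] by (intro point.map_cong) (auto simp: compose_def)
    show ?thesis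
      using adm e
      by (auto simp: generated_functor_def Comp_S_cat Comp_D2_cat compose_def restrict_def
          fun_eq_iff comp[unfolded compose_def restrict_def])
  qed
qed

lemma forget_generated_functor: "comp_funct forget (generated_functor e) = id_funct"
  by (simp add: comp_funct_def forget_def generated_functor_def id_funct_def fun_eq_iff)

text \<open>
  An infinite set is in bijection with its square. Iterating this pairing codes terms, the two
  constructors being told apart by tags \<open>c \<noteq> d\<close>.
\<close>

lemma inj_point_code:
  assumes "infinite (UNIV :: 'u set)"
  obtains e :: "'u point \<Rightarrow> 'u" where "inj e"
proof -
  obtain p :: "'u \<times> 'u \<Rightarrow> 'u" where "bij_betw p (UNIV \<times> UNIV) UNIV"
    using card_of_Times_same_infinite[OF assms] card_of_ordIso by blast
  then have p: "p (s, t) = p (s', t') \<longleftrightarrow> s = s' \<and> t = t'" for s t s' t'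
    by (auto simp: bij_betw_def inj_eq)
  obtain c d :: 'u where cd: "c \<noteq> d"
    using assms by (metis (full_types) UNIV_I finite.emptyI finite_insert finite_subset insertI1 subsetI)
  define e where "e = rec_point (\<lambda>s. p (c, s))
    (\<lambda>x y a b ex ey. p (d, p (ex, p (ey, p (a, b)))))"
  have e: "e (Base s) = p (c, s)" "e (Near x y a b) = p (d, p (e x, p (e y, p (a, b))))"
    for s x y a b
    by (simp_all add: e_def)
  have "e u = e v \<Longrightarrow> u = v" for u v
  proof (induction u arbitrary: v)
    case (Base s) then show ?case using cd by (cases v) (simp_all add: e p)
  next
    case (Near x y a b) then show ?case using cd by (cases v) (simp_all add: e p)
  qed
  then show ?thesis using that by (auto simp: inj_def)
qed


section \<open>Directed colimits\<close>

lemma is_funct_comp_funct: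
  assumes "is_funct C D F" "is_funct D E G"
  shows "is_funct C E (comp_funct G F)"
proof -
  interpret F: is_funct C D F by fact
  interpret G: is_funct D E G by fact
  show ?thesis
    by unfold_locales
      (simp_all add: comp_funct_def F.FOb_in_Ob F.FAr_in_Hom F.FAr_Id F.FAr_Comp
        G.FOb_in_Ob G.FAr_in_Hom G.FAr_Id G.FAr_Comp)
qed

lemma is_cocone_comp_funct:
  assumes F: "is_funct C D F" and G: "is_funct J C G" and c: "is_cocone J C G L \<iota>"
  shows "is_cocone J D (comp_funct F G) (FOb F L) (\<lambda>i. FAr F (FOb G i) L (\<iota> i))"
proof -
  interpret F: is_funct C D F by fact
  interpret G: is_funct J C G by fact
  show ?thesis
    unfolding is_cocone_def
  proof (intro conjI ballI)
    fix i j u assume ij: "i \<in> Ob J" "j \<in> Ob J" "u \<in> Hom J i j"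
    have "FAr F (FOb G i) L (\<iota> i) =
        FAr F (FOb G i) L (Comp C (FOb G i) (FOb G j) L (\<iota> j) (FAr G i j u))"
      using c ij unfolding is_cocone_def by simp
    also have "\<dots> = Comp D (FOb F (FOb G i)) (FOb F (FOb G j)) (FOb F L)
        (FAr F (FOb G j) L (\<iota> j)) (FAr F (FOb G i) (FOb G j) (FAr G i j u))"
      using c ij unfolding is_cocone_def
      by (intro F.FAr_Comp) (auto intro: G.FOb_in_Ob G.FAr_in_Hom)
    finally show "Comp D (FOb (comp_funct F G) i) (FOb (comp_funct F G) j) (FOb F L)
        (FAr F (FOb G j) L (\<iota> j)) (FAr (comp_funct F G) i j u) = FAr F (FOb G i) L (\<iota> i)"
      by (simp add: comp_funct_def)
  qed (use c in \<open>auto simp: is_cocone_def comp_funct_def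
         intro: F.FOb_in_Ob F.FAr_in_Hom G.FOb_in_Ob\<close>)
qed

lemma directed_finite_bound:
  assumes P: "directed_poset P"
    and mono: "\<And>i j. \<lbrakk>i \<in> carrier P; j \<in> carrier P; i \<sqsubseteq>\<^bsub>P\<^esub> j\<rbrakk> \<Longrightarrow> U i \<subseteq> U j"
    and F: "finite F" "F \<subseteq> (\<Union>i \<in> carrier P. U i)"
  shows "\<exists>i \<in> carrier P. F \<subseteq> U i"
  using F
proof (induction F rule: finite_induct)
  case empty
  then show ?case using P by (auto simp: directed_poset_def)
next
  case (insert x F)
  then obtain i j where ij: "i \<in> carrier P" "j \<in> carrier P" "F \<subseteq> U i" "x \<in> U j" by auto
  then obtain k where "k \<in> carrier P" "i \<sqsubseteq>\<^bsub>P\<^esub> k" "j \<sqsubseteq>\<^bsub>P\<^esub> k"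
    using P ij(1,2) unfolding directed_poset_def by blast
  then show ?case using ij mono[of i k] mono[of j k] by blast
qed

text \<open>
  A directed cocone of embeddings in \<open>\<S>\<close>. The index poset may be of any cardinality; the sets
  considered below all stay inside the carrier of the apex.
\<close>

locale S_cocone =
  fixes P :: "'i gorder" and G :: "('i, unit, 's gorder, 's \<Rightarrow> 's) funct" and L \<iota>
  assumes directed: "directed_poset P"
    and diagram: "is_funct (poset_cat P) S_cat G"
    and cocone: "is_cocone (poset_cat P) S_cat G L \<iota>"
begin

lemma FOb: "i \<in> carrier P \<Longrightarrow> distributive_semilattice (FOb G i)"
  using is_funct.FOb_in_Ob[OF diagram, of i] by (simp add: Ob_S_cat poset_cat_def)

lemma FAr:
  "\<lbrakk>i \<in> carrier P; j \<in> carrier P; i \<sqsubseteq>\<^bsub>P\<^esub> j\<rbrakk> \<Longrightarrow> FAr G i j () \<in> Hom S_cat (FOb G i) (FOb G j)"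
  using is_funct.FAr_in_Hom[OF diagram, of i j "()"] by (simp add: poset_cat_def)

lemma apex: "distributive_semilattice L"
  using cocone by (simp add: is_cocone_def Ob_S_cat)

lemma leg: "i \<in> carrier P \<Longrightarrow> \<iota> i \<in> Hom S_cat (FOb G i) L"
  using cocone by (simp add: is_cocone_def poset_cat_def)

lemma leg_hom:
  assumes "i \<in> carrier P"
  shows "\<iota> i \<in> semilattice_homs (FOb G i) L" "inj_on (\<iota> i) (carrier (FOb G i))"
  using leg[OF assms] by (simp_all add: Hom_S_cat)

lemma leg_mem: "\<lbrakk>i \<in> carrier P; x \<in> carrier (FOb G i)\<rbrakk> \<Longrightarrow> \<iota> i x \<in> carrier L"
  using leg_hom(1)[of i] by (auto simp: semilattice_homs_def)

lemma compat:
  assumes "i \<in> carrier P" "j \<in> carrier P" "i \<sqsubseteq>\<^bsub>P\<^esub> j" "x \<in> carrier (FOb G i)"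
  shows "FAr G i j () x \<in> carrier (FOb G j)" "\<iota> j (FAr G i j () x) = \<iota> i x"
proof -
  show "FAr G i j () x \<in> carrier (FOb G j)"
    using FAr[OF assms(1-3)] assms(4) by (auto simp: Hom_S_cat semilattice_homs_def)
  have "compose (carrier (FOb G i)) (\<iota> j) (FAr G i j ()) = \<iota> i"
    using cocone assms(1-3) by (simp add: is_cocone_def poset_cat_def Comp_S_cat)
  then show "\<iota> j (FAr G i j () x) = \<iota> i x"
    using assms(4) by (metis compose_eq)
qed

lemma images_mono:
  assumes "i \<in> carrier P" "j \<in> carrier P" "i \<sqsubseteq>\<^bsub>P\<^esub> j"
  shows "\<iota> i ` carrier (FOb G i) \<subseteq> \<iota> j ` carrier (FOb G j)"
  using compat[OF assms] by (metis image_eqI image_subsetI)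

lemma finite_subset_of_image:
  assumes "finite F" "F \<subseteq> (\<Union>i \<in> carrier P. \<iota> i ` carrier (FOb G i))"
  obtains i where "i \<in> carrier P" "F \<subseteq> \<iota> i ` carrier (FOb G i)"
  using directed_finite_bound[OF directed images_mono assms] by blast

text \<open>
  Any instance of distributivity involves three elements, which come from one object of the diagram;
  there it can be solved because the leg, being an embedding, reflects the order.
\<close>

lemma distributive_union:
  defines "U \<equiv> \<Union>i \<in> carrier P. \<iota> i ` carrier (FOb G i)"
  shows "distributive_semilattice (L\<lparr>carrier := U\<rparr>)"
    and "U \<subseteq> carrier L" and "\<bottom>\<^bsub>L\<lparr>carrier := U\<rparr>\<^esub> = \<bottom>\<^bsub>L\<^esub>"
    and "\<lbrakk>x \<in> U; y \<in> U\<rbrakk> \<Longrightarrow> x \<squnion>\<^bsub>L\<lparr>carrier := U\<rparr>\<^esub> y = x \<squnion>\<^bsub>L\<^esub> y"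
proof -
  interpret L: distributive_semilattice L by (rule apex)
  let ?U = "L\<lparr>carrier := U\<rparr>"
  have memU: "\<iota> i x \<in> U" if "i \<in> carrier P" "x \<in> carrier (FOb G i)" for i x
    using that by (auto simp: U_def)
  have common_index: "\<exists>i \<in> carrier P. \<exists>x' \<in> carrier (FOb G i). \<exists>y' \<in> carrier (FOb G i).
      \<exists>z' \<in> carrier (FOb G i). x = \<iota> i x' \<and> y = \<iota> i y' \<and> z = \<iota> i z'"
    if xyz: "x \<in> U" "y \<in> U" "z \<in> U" for x y z
  proof -
    obtain i where "i \<in> carrier P" "{x, y, z} \<subseteq> \<iota> i ` carrier (FOb G i)"
      by (rule finite_subset_of_image[of "{x, y, z}"]) (use xyz in \<open>simp_all add: U_def\<close>)
    then show ?thesis by (intro bexI[of _ i]) auto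
  qed
  show sub: "U \<subseteq> carrier L"
    using leg_mem by (auto simp: U_def)
  obtain i where i: "i \<in> carrier P"
    using directed by (auto simp: directed_poset_def)
  then have "join_semilattice_zero (FOb G i)"
    by (intro distributive_semilattice_join_semilattice_zero FOb)
  then have "\<bottom>\<^bsub>FOb G i\<^esub> \<in> carrier (FOb G i)"
    by (simp add: join_semilattice_zero_def weak_partial_order_bottom.bottom_closed)
  then have bot: "\<bottom>\<^bsub>L\<^esub> \<in> U"
    using memU[OF i] leg_hom(1)[OF i] by (force simp: semilattice_homs_def)
  have join: "x \<squnion>\<^bsub>L\<^esub> y \<in> U" if xy: "x \<in> U" "y \<in> U" for x y
  proof -
    obtain i x' y' where i: "i \<in> carrier P" and xy': "x' \<in> carrier (FOb G i)"
      "y' \<in> carrier (FOb G i)" "x = \<iota> i x'" "y = \<iota> i y'"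
      using common_index[OF xy xy(1)] by blast
    interpret Gi: distributive_semilattice "FOb G i" by (rule FOb[OF i])
    have "x \<squnion>\<^bsub>L\<^esub> y = \<iota> i (x' \<squnion>\<^bsub>FOb G i\<^esub> y')"
      using leg_hom(1)[OF i] xy' by (simp add: semilattice_homs_def)
    then show ?thesis using memU[OF i] xy' by simp
  qed
  note subU = L.subsemilattice[OF sub bot join]
  interpret U: join_semilattice_zero ?U by (rule subU(1))
  show bot_eq: "\<bottom>\<^bsub>?U\<^esub> = \<bottom>\<^bsub>L\<^esub>" by (rule subU(2))
  show join_eq: "x \<squnion>\<^bsub>?U\<^esub> y = x \<squnion>\<^bsub>L\<^esub> y" if "x \<in> U" "y \<in> U" for x y
    using that by (intro subU(3))
  show "distributive_semilattice ?U"
  proof unfold_locales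
    fix a b c
    assume abc: "a \<in> carrier ?U" "b \<in> carrier ?U" "c \<in> carrier ?U" "c \<sqsubseteq>\<^bsub>?U\<^esub> a \<squnion>\<^bsub>?U\<^esub> b"
    then obtain i a' b' c' where i: "i \<in> carrier P"
      and abc': "a' \<in> carrier (FOb G i)" "b' \<in> carrier (FOb G i)" "c' \<in> carrier (FOb G i)"
      "a = \<iota> i a'" "b = \<iota> i b'" "c = \<iota> i c'"
      using common_index[of a b c] by auto
    interpret Gi: distributive_semilattice "FOb G i" by (rule FOb[OF i])
    have hom: "\<iota> i (x \<squnion>\<^bsub>FOb G i\<^esub> y) = \<iota> i x \<squnion>\<^bsub>L\<^esub> \<iota> i y"
      if "x \<in> carrier (FOb G i)" "y \<in> carrier (FOb G i)" for x y
      using leg_hom(1)[OF i] that by (simp add: semilattice_homs_def)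
    have le_iff: "\<iota> i x \<sqsubseteq>\<^bsub>L\<^esub> \<iota> i y \<longleftrightarrow> x \<sqsubseteq>\<^bsub>FOb G i\<^esub> y"
      if "x \<in> carrier (FOb G i)" "y \<in> carrier (FOb G i)" for x y
      using Gi.join_semilattice_zero_axioms L.join_semilattice_zero_axioms leg_hom[OF i] that
      by (rule embedding_le_iff)
    have "\<iota> i c' \<sqsubseteq>\<^bsub>L\<^esub> \<iota> i (a' \<squnion>\<^bsub>FOb G i\<^esub> b')"
      using abc abc' hom join_eq by simp
    then have "c' \<sqsubseteq>\<^bsub>FOb G i\<^esub> a' \<squnion>\<^bsub>FOb G i\<^esub> b'"
      using abc' le_iff by simp
    then obtain a'' b'' where *: "a'' \<in> carrier (FOb G i)" "b'' \<in> carrier (FOb G i)"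
      "a'' \<sqsubseteq>\<^bsub>FOb G i\<^esub> a'" "b'' \<sqsubseteq>\<^bsub>FOb G i\<^esub> b'" "c' = a'' \<squnion>\<^bsub>FOb G i\<^esub> b''"
      using Gi.distributive abc' by blast
    have U: "\<iota> i a'' \<in> U" "\<iota> i b'' \<in> U"
      using memU[OF i] * by auto
    show "\<exists>a'\<in>carrier ?U. \<exists>b'\<in>carrier ?U. a' \<sqsubseteq>\<^bsub>?U\<^esub> a \<and> b' \<sqsubseteq>\<^bsub>?U\<^esub> b \<and> c = a' \<squnion>\<^bsub>?U\<^esub> b'"
    proof (intro bexI conjI)
      show "c = \<iota> i a'' \<squnion>\<^bsub>?U\<^esub> \<iota> i b''"
        using * abc' hom join_eq[OF U] by simp
    qed (use U * abc' le_iff in auto)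
  qed
qed

text \<open>
  The union of the images is an object of \<open>\<S>\<close> and receives the cocone. The induced map from \<open>L\<close> into
  it, followed by the inclusion, fixes all legs and so is the identity of \<open>L\<close>.
\<close>

lemma colimit_is_union_of_images:
  assumes colim: "is_colimit (poset_cat P) S_cat G L \<iota>"
  shows "carrier L = (\<Union>i \<in> carrier P. \<iota> i ` carrier (FOb G i))"
proof -
  define U where "U = (\<Union>i \<in> carrier P. \<iota> i ` carrier (FOb G i))"
  let ?U = "L\<lparr>carrier := U\<rparr>"
  note U = distributive_union[folded U_def]
  have Ob_P: "Ob (poset_cat P) = carrier P"
    by (simp add: poset_cat_def)
  have "is_cocone (poset_cat P) S_cat G ?U \<iota>"
  proof -
    have "\<iota> i \<in> Hom S_cat (FOb G i) ?U" if "i \<in> carrier P" for i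
    proof -
      have mem: "\<iota> i x \<in> U" if "x \<in> carrier (FOb G i)" for x
        using \<open>i \<in> carrier P\<close> that by (auto simp: U_def)
      then show ?thesis
        using leg_hom[OF that] U(3,4) by (auto simp: Hom_S_cat semilattice_homs_def PiE_iff)
    qed
    then show ?thesis
      using cocone U(1) by (simp add: is_cocone_def Ob_S_cat poset_cat_def Comp_S_cat)
  qed
  then obtain h where h: "h \<in> Hom S_cat L ?U"
    and h\<iota>: "\<And>i. i \<in> carrier P \<Longrightarrow> Comp S_cat (FOb G i) L ?U h (\<iota> i) = \<iota> i"
    using colim unfolding is_colimit_def Ob_P by blast
  have "h \<in> Hom S_cat L L"
    using h U(2-4) by (auto simp: Hom_S_cat semilattice_homs_def PiE_iff subset_iff)
  moreover have "restrict (\<lambda>x. x) (carrier L) \<in> Hom S_cat L L"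
    using category.Id_in_Hom[OF category_S_cat, of L] apex by (simp add: Ob_S_cat S_cat_def)
  moreover have "Comp S_cat (FOb G i) L L (restrict (\<lambda>x. x) (carrier L)) (\<iota> i) = \<iota> i"
    if "i \<in> carrier P" for i
    using leg_hom(1)[OF that]
    by (simp add: Comp_S_cat compose_restrict_left[OF semilattice_homs_PiE])
  moreover have "Comp S_cat (FOb G i) L L h (\<iota> i) = \<iota> i" if "i \<in> carrier P" for i
    using h\<iota>[OF that] by (simp add: Comp_S_cat)
  ultimately have h_id: "h = restrict (\<lambda>x. x) (carrier L)"
    using colim cocone unfolding is_colimit_def Ob_P by blast
  have "carrier L \<subseteq> U"
  proof
    fix x assume "x \<in> carrier L"
    then show "x \<in> U"
      using h unfolding h_id by (auto simp: Hom_S_cat semilattice_homs_def PiE_iff)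
  qed
  then show ?thesis
    using U(2) by (simp add: U_def)
qed

text \<open>
  The finitely many elements in a point over \<open>L\<close> all come from one object of the diagram. Renaming
  them to their preimages there gives an admissible point that the leg maps back.
\<close>

lemma generated_points_union:
  assumes e: "inj e" and L: "carrier L = (\<Union>i \<in> carrier P. \<iota> i ` carrier (FOb G i))"
  shows "points (generated_space e L) =
    (\<Union>i \<in> carrier P. fst (FAr (generated_functor e) (FOb G i) L (\<iota> i)) `
      points (generated_space e (FOb G i)))" (is "_ = ?R")
proof
  show "?R \<subseteq> points (generated_space e L)"
  proof (intro UN_least image_subsetI)
    fix i p assume i: "i \<in> carrier P" and p: "p \<in> points (generated_space e (FOb G i))"
    show "fst (FAr (generated_functor e) (FOb G i) L (\<iota> i)) p \<in> points (generated_space e L)"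
      using Hom_D2_catD(1)[OF generated_functor_in_Hom[OF FOb[OF i] apex leg[OF i] e]] p
      by (rule PiE_mem)
  qed
  show "points (generated_space e L) \<subseteq> ?R"
  proof
    fix p assume "p \<in> points (generated_space e L)"
    then obtain u where p: "p = e u" and u: "admissible L u" by auto
    have "finite (elements u)" by (induction u) auto
    then obtain i where i: "i \<in> carrier P" and elems: "elements u \<subseteq> \<iota> i ` carrier (FOb G i)"
      using finite_subset_of_image elements_admissible[OF u] L by metis
    let ?v = "map_point (inv_into (carrier (FOb G i)) (\<iota> i)) u"
    have v: "elements ?v \<subseteq> carrier (FOb G i)"
      using elems by (auto simp: point.set_map intro: inv_into_into)
    have "map_point (\<iota> i) ?v = map_point (\<lambda>s. s) u"
      unfolding point.map_comp using elems
      by (intro point.map_cong) (auto intro: f_inv_into_f)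
    then have u_eq: "map_point (\<iota> i) ?v = u" by (simp add: point.map_ident)
    have "admissible L (map_point (\<iota> i) ?v) \<longleftrightarrow> admissible (FOb G i) ?v"
      using v by (intro admissible_map_point_iff distributive_semilattice_join_semilattice_zero
          FOb[OF i] apex leg_hom[OF i])
    then have adm: "admissible (FOb G i) ?v" using u u_eq by simp
    then have "fst (FAr (generated_functor e) (FOb G i) L (\<iota> i)) (e ?v) = p"
      using e by (simp add: generated_functor_def u_eq p)
    then show "p \<in> ?R" using i adm by force
  qed
qed

end

text \<open>
  For a competing cocone, the map on values is the one induced in \<open>\<S>\<close>, and joint surjectivity leaves
  one candidate for the map on points. It is well defined since two points with the same image
  in \<open>\<delta>\<close> already agree further along the diagram, where the legs are one-to-one. Its injectivity
  comes for free, as the kernel of \<open>\<delta>\<close> is trivial and the map on values is one-to-one.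
\<close>

lemma colimit_D2_if_colimit_S:
  assumes P: "directed_poset P" and H: "is_funct (poset_cat P) D2_cat H"
    and cocone: "is_cocone (poset_cat P) D2_cat H \<delta> \<Lambda>"
    and colim: "is_colimit (poset_cat P) S_cat (comp_funct forget H) (vals \<delta>) (\<lambda>i. snd (\<Lambda> i))"
    and points: "points \<delta> = (\<Union>i \<in> carrier P. fst (\<Lambda> i) ` points (FOb H i))"
  shows "is_colimit (poset_cat P) D2_cat H \<delta> \<Lambda>"
  unfolding is_colimit_def
proof (intro conjI allI impI)
  fix \<epsilon> \<kappa> assume \<kappa>: "is_cocone (poset_cat P) D2_cat H \<epsilon> \<kappa>"
  have Ob_P: "Ob (poset_cat P) = carrier P"
    by (simp add: poset_cat_def)
  have leg: "\<mu> i \<in> Hom D2_cat (FOb H i) \<zeta>"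
    if "is_cocone (poset_cat P) D2_cat H \<zeta> \<mu>" "i \<in> carrier P" for \<zeta> \<mu> i
    using that by (simp add: is_cocone_def Ob_P)
  have arrow: "FAr H i j () \<in> Hom D2_cat (FOb H i) (FOb H j)"
    if "i \<in> carrier P" "j \<in> carrier P" "i \<sqsubseteq>\<^bsub>P\<^esub> j" for i j
    using is_funct.FAr_in_Hom[OF H, of i j "()"] that by (simp add: poset_cat_def)
  have arrow_mem: "fst (FAr H i j ()) x \<in> points (FOb H j)"
    if "i \<in> carrier P" "j \<in> carrier P" "i \<sqsubseteq>\<^bsub>P\<^esub> j" "x \<in> points (FOb H i)" for i j x
    using Hom_D2_catD(1)[OF arrow[OF that(1-3)]] that(4) by (rule PiE_mem)
  have compat: "fst (\<mu> j) (fst (FAr H i j ()) x) = fst (\<mu> i) x"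
    if \<mu>: "is_cocone (poset_cat P) D2_cat H \<zeta> \<mu>"
      and ij: "i \<in> carrier P" "j \<in> carrier P" "i \<sqsubseteq>\<^bsub>P\<^esub> j" and x: "x \<in> points (FOb H i)"
    for \<zeta> \<mu> i j x
  proof -
    have "Comp D2_cat (FOb H i) (FOb H j) \<zeta> (\<mu> j) (FAr H i j ()) = \<mu> i"
      using \<mu> ij by (simp add: is_cocone_def poset_cat_def)
    then have "compose (points (FOb H i)) (fst (\<mu> j)) (fst (FAr H i j ())) = fst (\<mu> i)"
      by (metis Comp_D2_cat fst_conv)
    then show ?thesis using x by (metis compose_eq)
  qed
  have common: "\<exists>k \<in> carrier P. i \<sqsubseteq>\<^bsub>P\<^esub> k \<and> j \<sqsubseteq>\<^bsub>P\<^esub> k" if "i \<in> carrier P" "j \<in> carrier P" for i j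
    using P that unfolding directed_poset_def by blast
  have welldef: "fst (\<kappa> i) x = fst (\<kappa> j) y"
    if ij: "i \<in> carrier P" "j \<in> carrier P" and xy: "x \<in> points (FOb H i)" "y \<in> points (FOb H j)"
      and eq: "fst (\<Lambda> i) x = fst (\<Lambda> j) y" for i j x y
  proof -
    obtain k where k: "k \<in> carrier P" "i \<sqsubseteq>\<^bsub>P\<^esub> k" "j \<sqsubseteq>\<^bsub>P\<^esub> k"
      using common[OF ij] by blast
    let ?x = "fst (FAr H i k ()) x" and ?y = "fst (FAr H j k ()) y"
    have mem: "?x \<in> points (FOb H k)" "?y \<in> points (FOb H k)"
      using arrow_mem[OF ij(1) k(1,2) xy(1)] arrow_mem[OF ij(2) k(1,3) xy(2)] .
    have "fst (\<Lambda> k) ?x = fst (\<Lambda> k) ?y"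
      using compat[OF cocone ij(1) k(1,2) xy(1)] compat[OF cocone ij(2) k(1,3) xy(2)] eq by simp
    then have "?x = ?y"
      using Hom_D2_catD(4)[OF leg[OF cocone k(1)]] mem by (simp add: inj_on_eq_iff)
    then show ?thesis
      using compat[OF \<kappa> ij(1) k(1,2) xy(1)] compat[OF \<kappa> ij(2) k(1,3) xy(2)] by simp
  qed
  have "\<exists>f. \<forall>p \<in> points \<delta>. \<forall>i \<in> carrier P. \<forall>x \<in> points (FOb H i).
      fst (\<Lambda> i) x = p \<longrightarrow> fst (\<kappa> i) x = f p"
  proof (rule bchoice, rule ballI)
    fix p assume "p \<in> points \<delta>"
    then obtain i x where "i \<in> carrier P" "x \<in> points (FOb H i)" "p = fst (\<Lambda> i) x"
      unfolding points by blast
    then show "\<exists>y. \<forall>i \<in> carrier P. \<forall>x \<in> points (FOb H i). fst (\<Lambda> i) x = p \<longrightarrow> fst (\<kappa> i) x = y"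
      using welldef by blast
  qed
  then obtain f0 where f0: "\<forall>p \<in> points \<delta>. \<forall>i \<in> carrier P. \<forall>x \<in> points (FOb H i).
      fst (\<Lambda> i) x = p \<longrightarrow> fst (\<kappa> i) x = f0 p" ..
  define f where "f = restrict f0 (points \<delta>)"
  have f: "f (fst (\<Lambda> i) x) = fst (\<kappa> i) x" if "i \<in> carrier P" "x \<in> points (FOb H i)" for i x
  proof -
    have "fst (\<Lambda> i) x \<in> points \<delta>" unfolding points using that by blast
    then show ?thesis using f0 that by (simp add: f_def)
  qed
  have "is_cocone (poset_cat P) S_cat (comp_funct forget H) (vals \<epsilon>) (\<lambda>i. snd (\<kappa> i))"
    using is_cocone_comp_funct[OF is_funct_forget_D2 H \<kappa>] by (simp add: forget_def)
  then have ex1: "\<exists>!g. g \<in> Hom S_cat (vals \<delta>) (vals \<epsilon>) \<and>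
      (\<forall>i \<in> carrier P. compose (carrier (vals (FOb H i))) g (snd (\<Lambda> i)) = snd (\<kappa> i))"
    using colim unfolding is_colimit_def Ob_P
    by (simp add: Comp_S_cat comp_funct_def forget_def)
  then obtain g where g: "g \<in> Hom S_cat (vals \<delta>) (vals \<epsilon>)"
    and g\<Lambda>: "\<And>i. i \<in> carrier P \<Longrightarrow> compose (carrier (vals (FOb H i))) g (snd (\<Lambda> i)) = snd (\<kappa> i)"
    by blast
  have dist: "distance (FOb H i)" if "i \<in> carrier P" for i
    using is_funct.FOb_in_Ob[OF H, of i] that by (simp add: Ob_D2_cat Ob_P)
  have isometry: "g (dst \<delta> p q) = dst \<epsilon> (f p) (f q)" if pq: "p \<in> points \<delta>" "q \<in> points \<delta>" for p q
  proof -
    obtain i j x y where ij: "i \<in> carrier P" "j \<in> carrier P"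
      and xy: "x \<in> points (FOb H i)" "y \<in> points (FOb H j)" "p = fst (\<Lambda> i) x" "q = fst (\<Lambda> j) y"
      using pq unfolding points by blast
    obtain k where k: "k \<in> carrier P" "i \<sqsubseteq>\<^bsub>P\<^esub> k" "j \<sqsubseteq>\<^bsub>P\<^esub> k"
      using common[OF ij] by blast
    let ?x = "fst (FAr H i k ()) x" and ?y = "fst (FAr H j k ()) y"
    have mem: "?x \<in> points (FOb H k)" "?y \<in> points (FOb H k)"
      using arrow_mem[OF ij(1) k(1,2) xy(1)] arrow_mem[OF ij(2) k(1,3) xy(2)] .
    have p: "p = fst (\<Lambda> k) ?x" and q: "q = fst (\<Lambda> k) ?y"
      using compat[OF cocone ij(1) k(1,2) xy(1)] compat[OF cocone ij(2) k(1,3) xy(2)] xy(3,4)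
      by simp_all
    have "g (dst \<delta> p q) = g (snd (\<Lambda> k) (dst (FOb H k) ?x ?y))"
      unfolding p q using Hom_D2_catD(3)[OF leg[OF cocone k(1)] mem] by simp
    also have "\<dots> = snd (\<kappa> k) (dst (FOb H k) ?x ?y)"
      using g\<Lambda>[OF k(1)] distance.dst_in_vals[OF dist[OF k(1)] mem] by (metis compose_eq)
    also have "\<dots> = dst \<epsilon> (f p) (f q)"
      unfolding p q using Hom_D2_catD(3)[OF leg[OF \<kappa> k(1)] mem] f[OF k(1)] mem by simp
    finally show ?thesis .
  qed
  have f_mem: "f \<in> points \<delta> \<rightarrow>\<^sub>E points \<epsilon>"
  proof (rule PiE_I)
    fix p assume "p \<in> points \<delta>"
    then obtain i x where ix: "i \<in> carrier P" "x \<in> points (FOb H i)" "p = fst (\<Lambda> i) x"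
      unfolding points by blast
    show "f p \<in> points \<epsilon>"
      unfolding ix(3) f[OF ix(1,2)] using Hom_D2_catD(1)[OF leg[OF \<kappa> ix(1)]] ix(2) by (rule PiE_mem)
  qed (simp add: f_def)
  have "inj_on f (points \<delta>)"
  proof (rule inj_onI)
    fix p q assume pq: "p \<in> points \<delta>" "q \<in> points \<delta>" "f p = f q"
    have \<epsilon>: "distance \<epsilon>" using \<kappa> by (simp add: is_cocone_def Ob_D2_cat)
    have \<delta>: "distance \<delta>" "distance_kernel \<delta> = Id_on (points \<delta>)"
      using cocone by (simp_all add: is_cocone_def Ob_D2_cat)
    have "g (dst \<delta> p q) = \<bottom>\<^bsub>vals \<epsilon>\<^esub>"
      using isometry[OF pq(1,2)] distance.dst_self[OF \<epsilon>] PiE_mem[OF f_mem pq(2)] pq(3) by simp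
    moreover have "g \<bottom>\<^bsub>vals \<delta>\<^esub> = \<bottom>\<^bsub>vals \<epsilon>\<^esub>" "inj_on g (carrier (vals \<delta>))"
      using g by (simp_all add: Hom_S_cat semilattice_homs_def)
    moreover have "\<bottom>\<^bsub>vals \<delta>\<^esub> \<in> carrier (vals \<delta>)"
      using distance.dst_self[OF \<delta>(1) pq(1)] distance.dst_in_vals[OF \<delta>(1) pq(1,1)] by simp
    ultimately have "dst \<delta> p q = \<bottom>\<^bsub>vals \<delta>\<^esub>"
      using distance.dst_in_vals[OF \<delta>(1) pq(1,2)] by (metis inj_onD)
    then have "(p, q) \<in> distance_kernel \<delta>"
      using pq by (simp add: distance_kernel_def)
    then show "p = q" unfolding \<delta>(2) by (simp add: Id_on_def)
  qed
  then have fg: "(f, g) \<in> Hom D2_cat \<delta> \<epsilon>"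
    using g f_mem isometry by (simp add: Hom_D2_cat distance_morphisms_def Hom_S_cat)
  show "\<exists>!h. h \<in> Hom D2_cat \<delta> \<epsilon> \<and>
      (\<forall>i \<in> Ob (poset_cat P). Comp D2_cat (FOb H i) \<delta> \<epsilon> h (\<Lambda> i) = \<kappa> i)"
    unfolding Ob_P
  proof (rule ex1I[of _ "(f, g)"], intro conjI ballI)
    fix i assume i: "i \<in> carrier P"
    have "compose (points (FOb H i)) f (fst (\<Lambda> i)) = fst (\<kappa> i)"
      using f[OF i] Hom_D2_catD(1)[OF leg[OF \<kappa> i]]
      by (auto simp: compose_def fun_eq_iff PiE_iff extensional_def)
    then show "Comp D2_cat (FOb H i) \<delta> \<epsilon> (f, g) (\<Lambda> i) = \<kappa> i"
      using g\<Lambda>[OF i] by (simp add: Comp_D2_cat prod_eq_iff)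
  next
    fix h assume h: "h \<in> Hom D2_cat \<delta> \<epsilon> \<and>
      (\<forall>i \<in> carrier P. Comp D2_cat (FOb H i) \<delta> \<epsilon> h (\<Lambda> i) = \<kappa> i)"
    then have hom: "h \<in> Hom D2_cat \<delta> \<epsilon>" by blast
    have comp: "compose (points (FOb H i)) (fst h) (fst (\<Lambda> i)) = fst (\<kappa> i)"
      "compose (carrier (vals (FOb H i))) (snd h) (snd (\<Lambda> i)) = snd (\<kappa> i)"
      if "i \<in> carrier P" for i
      using h that by (metis Comp_D2_cat fst_conv, metis Comp_D2_cat snd_conv)
    have "snd h = g"
      using ex1 g g\<Lambda> comp(2) Hom_D2_catD(2,5)[OF hom] unfolding Hom_S_cat by blast
    moreover have "fst h = f"
    proof (rule PiE_ext[OF Hom_D2_catD(1)[OF hom] f_mem])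
      fix p assume "p \<in> points \<delta>"
      then obtain i x where ix: "i \<in> carrier P" "x \<in> points (FOb H i)" "p = fst (\<Lambda> i) x"
        unfolding points by blast
      then show "fst h p = f p"
        using comp(1)[OF ix(1)] f[OF ix(1,2)] by (metis compose_eq)
    qed
    ultimately show "h = (f, g)" by (simp add: prod_eq_iff)
  qed (rule fg)
qed (rule cocone)

lemma generated_functor_preserves_directed_colimits:
  fixes e :: "'a point \<Rightarrow> 'a"
  assumes e: "inj e" and P: "directed_poset P"
  shows "preserves_colimits_over (poset_cat P) S_cat D2_cat (generated_functor e)"
  unfolding preserves_colimits_over_def
proof (intro allI impI, elim conjE)
  fix G :: "('b, unit, 'a gorder, 'a \<Rightarrow> 'a) funct" and L \<iota>
  assume G: "is_funct (poset_cat P) S_cat G" and colim: "is_colimit (poset_cat P) S_cat G L \<iota>"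
  let ?\<Phi> = "generated_functor e"
  have cocone: "is_cocone (poset_cat P) S_cat G L \<iota>"
    using colim by (simp add: is_colimit_def)
  interpret S_cocone P G L \<iota>
    using P G cocone by (rule S_cocone.intro)
  have "comp_funct forget (comp_funct ?\<Phi> G) = G"
    by (simp add: comp_funct_def forget_def generated_functor_def)
  then have "is_colimit (poset_cat P) S_cat (comp_funct forget (comp_funct ?\<Phi> G))
      (vals (FOb ?\<Phi> L)) (\<lambda>i. snd (FAr ?\<Phi> (FOb G i) L (\<iota> i)))"
    using colim by (simp add: generated_functor_def)
  moreover have "points (FOb ?\<Phi> L) = (\<Union>i \<in> carrier P.
      fst (FAr ?\<Phi> (FOb G i) L (\<iota> i)) ` points (FOb (comp_funct ?\<Phi> G) i))"
    using generated_points_union[OF e colimit_is_union_of_images[OF colim]]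
    by (simp add: comp_funct_def generated_functor_def)
  ultimately show "is_colimit (poset_cat P) D2_cat (comp_funct ?\<Phi> G) (FOb ?\<Phi> L)
      (\<lambda>i. FAr ?\<Phi> (FOb G i) L (\<iota> i))"
    by (intro colimit_D2_if_colimit_S P is_funct_comp_funct[OF G]
        is_cocone_comp_funct[OF _ G cocone] is_funct_generated_functor e)
qed

lemma naturally_isomorphic_refl:
  assumes "is_funct C D F"
  shows "naturally_isomorphic C D F F"
proof -
  interpret is_funct C D F by fact
  show ?thesis
    unfolding naturally_isomorphic_def is_iso_def
    using assms FOb_in_Ob FAr_in_Hom D.Id_in_Hom D.Comp_Id_left D.Comp_Id_right
    by (intro conjI exI[of _ "\<lambda>A. Id D (FOb F A)"]) auto
qed

lemma is_funct_id_funct: "category C \<Longrightarrow> is_funct C C id_funct"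
  by (simp add: is_funct_def is_funct_axioms_def id_funct_def)

theorem theorem7p1:
  assumes "infinite (UNIV :: 'u set)"
  shows "\<exists>\<Phi> :: ('u gorder, 'u \<Rightarrow> 'u, ('u, 'u) distance_space, ('u \<Rightarrow> 'u) \<times> ('u \<Rightarrow> 'u)) funct.
    is_funct S_cat D2_cat \<Phi> \<and>
    (\<forall>P :: 'i gorder. directed_poset P \<longrightarrow>
      preserves_colimits_over (poset_cat P) S_cat D2_cat \<Phi>) \<and>
    naturally_isomorphic S_cat S_cat (comp_funct forget \<Phi>) id_funct"
proof -
  obtain e :: "'u point \<Rightarrow> 'u" where e: "inj e"
    using inj_point_code[OF assms] .
  show ?thesis
  proof (rule exI[of _ "generated_functor e"], intro conjI allI impI)
    show "naturally_isomorphic S_cat S_cat (comp_funct forget (generated_functor e)) id_funct"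
      unfolding forget_generated_functor
      by (rule naturally_isomorphic_refl[OF is_funct_id_funct[OF category_S_cat]])
  qed (rule is_funct_generated_functor[OF e] generated_functor_preserves_directed_colimits[OF e],
      assumption?)+
qed

end
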